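(* Fix a finite graph $\mathcal{G}$ of constant degree $d$ and a set $\{a_\alpha,b_j\}_{\alpha\in E(\mathcal{G}),\,j\in V(\mathcal{G})}$ of Jacobi parameters on it. Let $\psi$ be the strictly positive normalized eigenvector of the Jacobi matrix $J=J(a,b)$ for its largest eigenvalue $\sigma(a,b)$, and let $$S=\sup_{\alpha=(i,j)\in E(\mathcal{G})}\left[a_\alpha\psi_i\psi_j\right],\qquad \tilde S=\sup_{\alpha=(i,j)\in E(\mathcal{G})}\left[\frac{1}{a_\alpha\psi_i\psi_j}\right],$$ $$I=\inf_{i\in V(\mathcal{G})}\psi_i^2,\qquad \tilde I=\inf_{i\in V(\mathcal{G})}\frac{1}{\psi_i^2}.$$ Then $$\frac{\tilde I}{\tilde S}\left(d-\sqrt{4(d-1)}\right)\le G(a,b)\le\frac{S}{I}\left(d-\sqrt{4(d-1)}\right).$$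
   Context: Graphs: $\mathcal{G}$ is a finite, connected, leafless graph (every vertex has degree at least $2$) with vertex set $V(\mathcal{G})$ and edge set $E(\mathcal{G})$; multiple edges and self-loops are allowed, a self-loop counting twice in the degree. The notation $\alpha=(i,j)$ means that $i,j$ are the two ends of the edge $\alpha$. Jacobi parameters on $\mathcal{G}$ are numbers $a_\alpha>0$ for each edge $\alpha\in E(\mathcal{G})$ and $b_j\in\mathbb{R}$ for each $j\in V(\mathcal{G})$. The associated Jacobi matrix $J=J(a,b)$ acts on $\ell^2(V(\mathcal{G}))$ by $$(Ju)_j=b_ju_j+\sum_{\alpha}a_\alpha u_k,$$ the sum being over edges $\alpha$ with one end $j$ and other end $k$ (with multiplicity for multiple edges; a self-loop at $j$ contributes twice). Let $\mathcal{T}$ be the universal cover of $\mathcal{G}$ (here the homogeneous tree of degree $d$), with covering map $\pi:\mathcal{T}\to\mathcal{G}$. The parameters lift to $\mathcal{T}$ by assigning to each edge (vertex) of $\mathcal{T}$ the value of $a$ (of $b$) at its image under $\pi$. The bounded self-adjoint operator $H=H(a,b)$ on $\ell^2(V(\mathcal{T}))$ given by the same formula with the lifted parameters is the induced periodic Jacobi matrix. By the Perron--Frobenius theorem, $J(a,b)$ has a simple largest eigenvalue $\sigma(a,b)$ with a unique strictly positive eigenvector of $\ell^2$ norm $1$. Let $\Sigma(a,b)$ be the supremum of the spectrum of $H(a,b)$. The gap is $G(a,b)=\sigma(a,b)-\Sigma(a,b)$. *)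

theory Defs
  imports "HOL-Analysis.Analysis"
begin

text \<open>Graphs may have multiple edges and self-loops. The two ends of an edge are listed in an
  arbitrary order. Each edge \<open>e\<close>, self-loops included, has two orientations, or darts,
  \<open>(e, True)\<close> and \<open>(e, False)\<close>, which are exchanged by \<open>flip\<close>.\<close>

record ('v, 'e) multigraph =
  verts :: "'v set"
  edges :: "'e set"
  ends :: "'e \<Rightarrow> 'v \<times> 'v"

definition wf_multigraph :: "('v, 'e) multigraph \<Rightarrow> bool" where
  "wf_multigraph G \<longleftrightarrow> (\<forall>e\<in>edges G. fst (ends G e) \<in> verts G \<and> snd (ends G e) \<in> verts G)"

definition finite_multigraph :: "('v, 'e) multigraph \<Rightarrow> bool" where
  "finite_multigraph G \<longleftrightarrow> wf_multigraph G \<and> finite (verts G) \<and> finite (edges G)"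

definition darts :: "('v, 'e) multigraph \<Rightarrow> ('e \<times> bool) set" where
  "darts G = edges G \<times> UNIV"

definition flip :: "'e \<times> bool \<Rightarrow> 'e \<times> bool" where
  "flip x = (fst x, \<not> snd x)"

definition source :: "('v, 'e) multigraph \<Rightarrow> 'e \<times> bool \<Rightarrow> 'v" where
  "source G x = (if snd x then fst (ends G (fst x)) else snd (ends G (fst x)))"

definition target :: "('v, 'e) multigraph \<Rightarrow> 'e \<times> bool \<Rightarrow> 'v" where
  "target G x = source G (flip x)"

definition star :: "('v, 'e) multigraph \<Rightarrow> 'v \<Rightarrow> ('e \<times> bool) set" where
  "star G v = {x \<in> darts G. source G x = v}"

text \<open>Both darts of a self-loop at \<open>v\<close> lie in \<open>star G v\<close>, so a self-loop counts twice.\<close>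

definition degree :: "('v, 'e) multigraph \<Rightarrow> 'v \<Rightarrow> nat" where
  "degree G v = card (star G v)"

definition leafless :: "('v, 'e) multigraph \<Rightarrow> bool" where
  "leafless G \<longleftrightarrow> (\<forall>v\<in>verts G. degree G v \<ge> 2)"

fun walk :: "('v, 'e) multigraph \<Rightarrow> 'v \<Rightarrow> ('e \<times> bool) list \<Rightarrow> 'v \<Rightarrow> bool" where
  "walk G i [] j \<longleftrightarrow> i \<in> verts G \<and> i = j"
| "walk G i (x # xs) j \<longleftrightarrow> x \<in> star G i \<and> walk G (target G x) xs j"

definition connected_multigraph :: "('v, 'e) multigraph \<Rightarrow> bool" where
  "connected_multigraph G \<longleftrightarrow>
     verts G \<noteq> {} \<and> (\<forall>i\<in>verts G. \<forall>j\<in>verts G. \<exists>xs. walk G i xs j)"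

text \<open>A cycle repeats neither vertices nor edges. Self-loops are cycles of length one, and
  pairs of parallel edges are cycles of length two.\<close>

definition is_cycle :: "('v, 'e) multigraph \<Rightarrow> ('e \<times> bool) list \<Rightarrow> bool" where
  "is_cycle G xs \<longleftrightarrow>
     xs \<noteq> [] \<and> (\<exists>i. walk G i xs i) \<and> distinct (map (source G) xs) \<and> distinct (map fst xs)"

definition is_tree :: "('v, 'e) multigraph \<Rightarrow> bool" where
  "is_tree T \<longleftrightarrow> wf_multigraph T \<and> connected_multigraph T \<and> (\<nexists>xs. is_cycle T xs)"

text \<open>A covering map is given by its action \<open>p\<close> on vertices and its action \<open>q\<close> on darts. Using
  darts rather than edges records the direction in which an edge is mapped onto a self-loop.
  The underlying map of edges is \<open>\<lambda>f. fst (q (f, True))\<close>.\<close>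

definition covering_map ::
  "('t, 'f) multigraph \<Rightarrow> ('v, 'e) multigraph \<Rightarrow> ('t \<Rightarrow> 'v) \<Rightarrow> ('f \<times> bool \<Rightarrow> 'e \<times> bool) \<Rightarrow> bool"
where
  "covering_map T G p q \<longleftrightarrow>
     p ` verts T = verts G \<and>
     (\<forall>x\<in>darts T. q x \<in> darts G \<and> q (flip x) = flip (q x) \<and> source G (q x) = p (source T x)) \<and>
     (\<forall>v\<in>verts T. bij_betw q (star T v) (star G (p v)))"

definition universal_cover ::
  "('t, 'f) multigraph \<Rightarrow> ('v, 'e) multigraph \<Rightarrow> ('t \<Rightarrow> 'v) \<Rightarrow> ('f \<times> bool \<Rightarrow> 'e \<times> bool) \<Rightarrow> bool"
where
  "universal_cover T G p q \<longleftrightarrow> is_tree T \<and> covering_map T G p q"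

definition lift_edge_param :: "('f \<times> bool \<Rightarrow> 'e \<times> bool) \<Rightarrow> ('e \<Rightarrow> real) \<Rightarrow> 'f \<Rightarrow> real" where
  "lift_edge_param q a f = a (fst (q (f, True)))"

definition lift_vertex_param :: "('t \<Rightarrow> 'v) \<Rightarrow> ('v \<Rightarrow> real) \<Rightarrow> 't \<Rightarrow> real" where
  "lift_vertex_param p b v = b (p v)"

text \<open>Vectors indexed by a set \<open>V\<close> are functions, and elements of \<open>ell2 V\<close> vanish off \<open>V\<close>.\<close>

definition ell2 :: "'i set \<Rightarrow> ('i \<Rightarrow> complex) set" where
  "ell2 V = {u. (\<forall>i. i \<notin> V \<longrightarrow> u i = 0) \<and> (\<lambda>i. (cmod (u i))\<^sup>2) summable_on V}"

definition ell2_norm :: "'i set \<Rightarrow> ('i \<Rightarrow> complex) \<Rightarrow> real" where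
  "ell2_norm V u = sqrt (\<Sum>\<^sub>\<infinity>i\<in>V. (cmod (u i))\<^sup>2)"

definition resolvent_set :: "'i set \<Rightarrow> (('i \<Rightarrow> complex) \<Rightarrow> ('i \<Rightarrow> complex)) \<Rightarrow> complex set" where
  "resolvent_set V A =
     {z. bij_betw (\<lambda>u i. A u i - z * u i) (ell2 V) (ell2 V) \<and>
         (\<exists>C. \<forall>u\<in>ell2 V. ell2_norm V u \<le> C * ell2_norm V (\<lambda>i. A u i - z * u i))}"

definition spectrum :: "'i set \<Rightarrow> (('i \<Rightarrow> complex) \<Rightarrow> ('i \<Rightarrow> complex)) \<Rightarrow> complex set" where
  "spectrum V A = - resolvent_set V A"

text \<open>The sum over \<open>star G j\<close> runs over the edges at \<open>j\<close> with multiplicity, a self-loop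
  contributing twice. The scalars are left open (real or complex).\<close>

definition jacobi ::
  "('v, 'e) multigraph \<Rightarrow> ('e \<Rightarrow> real) \<Rightarrow> ('v \<Rightarrow> real) \<Rightarrow> ('v \<Rightarrow> 'c::real_vector) \<Rightarrow> 'v \<Rightarrow> 'c"
where
  "jacobi G a b u j =
     (if j \<in> verts G
      then b j *\<^sub>R u j + (\<Sum>x\<in>star G j. a (fst x) *\<^sub>R u (target G x)) else 0)"

definition eigenvalues :: "'i set \<Rightarrow> (('i \<Rightarrow> complex) \<Rightarrow> ('i \<Rightarrow> complex)) \<Rightarrow> complex set" where
  "eigenvalues V A = {z. \<exists>u\<in>ell2 V. u \<noteq> (\<lambda>_. 0) \<and> A u = (\<lambda>i. z * u i)}"

text \<open>The Jacobi operators are self-adjoint, so all their eigenvalues and their whole spectrum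
  are real.\<close>

definition largest_eigenvalue ::
  "('v, 'e) multigraph \<Rightarrow> ('e \<Rightarrow> real) \<Rightarrow> ('v \<Rightarrow> real) \<Rightarrow> real" where
  "largest_eigenvalue G a b =
     Max {x. complex_of_real x \<in> eigenvalues (verts G) (jacobi G a b)}"

definition perron_vector ::
  "('v, 'e) multigraph \<Rightarrow> ('e \<Rightarrow> real) \<Rightarrow> ('v \<Rightarrow> real) \<Rightarrow> ('v \<Rightarrow> real) \<Rightarrow> bool" where
  "perron_vector G a b \<psi> \<longleftrightarrow>
     (\<forall>j\<in>verts G. \<psi> j > 0) \<and> (\<Sum>j\<in>verts G. (\<psi> j)\<^sup>2) = 1 \<and>
     (\<forall>j\<in>verts G. jacobi G a b \<psi> j = largest_eigenvalue G a b * \<psi> j)"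

definition periodic_jacobi ::
  "('t, 'f) multigraph \<Rightarrow> ('t \<Rightarrow> 'v) \<Rightarrow> ('f \<times> bool \<Rightarrow> 'e \<times> bool) \<Rightarrow> ('e \<Rightarrow> real) \<Rightarrow> ('v \<Rightarrow> real) \<Rightarrow>
   ('t \<Rightarrow> complex) \<Rightarrow> 't \<Rightarrow> complex" where
  "periodic_jacobi T p q a b = jacobi T (lift_edge_param q a) (lift_vertex_param p b)"

definition spectral_top ::
  "('t, 'f) multigraph \<Rightarrow> ('t \<Rightarrow> 'v) \<Rightarrow> ('f \<times> bool \<Rightarrow> 'e \<times> bool) \<Rightarrow> ('e \<Rightarrow> real) \<Rightarrow> ('v \<Rightarrow> real) \<Rightarrow> real"
where
  "spectral_top T p q a b =
     Sup {x. complex_of_real x \<in> spectrum (verts T) (periodic_jacobi T p q a b)}"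

definition gap ::
  "('v, 'e) multigraph \<Rightarrow> ('t, 'f) multigraph \<Rightarrow> ('t \<Rightarrow> 'v) \<Rightarrow> ('f \<times> bool \<Rightarrow> 'e \<times> bool) \<Rightarrow>
   ('e \<Rightarrow> real) \<Rightarrow> ('v \<Rightarrow> real) \<Rightarrow> real" where
  "gap G T p q a b = largest_eigenvalue G a b - spectral_top T p q a b"

end

theory Submission
  imports Defs
begin

text \<open>With \<open>\<phi> = \<psi> \<circ> p\<close>, which satisfies \<open>H \<phi> = \<sigma> \<phi>\<close> formally on the tree, the ground state substitution
  \<open>u = \<phi> f\<close> turns \<open>\<langle>(\<sigma> - H) u, u\<rangle>\<close> into the sum of \<open>a\<^sub>\<alpha> \<phi>\<^sub>i \<phi>\<^sub>j (f\<^sub>i - f\<^sub>j)\<^sup>2\<close> over the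
  edges, which is compared with the free energy \<open>\<Sum>(f\<^sub>i - f\<^sub>j)\<^sup>2\<close>. On the \<open>d\<close>-regular tree the bottom
  of the free energy is \<open>d - 2 sqrt (d - 1)\<close>, by means of the radial function \<open>(d - 1) powr (-n/2)\<close>
  of the distance \<open>n\<close> to a root: it is a positive supersolution, and its truncations are almost
  minimizers. Only finitely supported real test functions are needed, because the Jacobi operator
  is local: the supremum of its form over them is the top of the spectrum.\<close>

section \<open>Darts and Jacobi operators on regular graphs\<close>

text \<open>The two quotients come from two independent losses. Replacing the edge weights by a
  constant costs the factor \<open>1 / S'\<close> from below and \<open>S\<close> from above;
  replacing the mass of \<open>f\<close> by that of \<open>u = \<phi> f\<close> costs
  \<open>I'\<close> and \<open>1 / I\<close>. Since \<phi> is a lift from a finite graph, all four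
  factors are positive and finite although the tree is infinite. The spectrum is defined by bounded
  invertibility, so its top has to be tied to the quadratic form by hand. Beyond the supremum of the
  form, a Neumann series gives the inverse; at the supremum, near-maximizers of the form turn out to
  be approximate eigenvectors. The exponent \<open>-n/2\<close> is the critical one: level
  \<open>n > 0\<close> has \<open>d (d - 1)^(n - 1)\<close> vertices, so all these levels carry the
  same square mass. The radial function just misses being square summable, and its truncation at
  level \<open>n\<close> has mass growing linearly in \<open>n\<close> against a defect that stays
  bounded.\<close>

lemma flip_flip [simp]: "flip (flip x) = x"
  by (simp add: flip_def)

lemma fst_flip [simp]: "fst (flip x) = fst x"
  by (simp add: flip_def)

lemma source_flip [simp]: "source G (flip x) = target G x"
  by (simp add: target_def)

lemma target_flip [simp]: "target G (flip x) = source G x"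
  by (simp add: target_def)

lemma flip_in_darts [simp]: "flip x \<in> darts G \<longleftrightarrow> x \<in> darts G"
  by (simp add: darts_def flip_def mem_Times_iff)

lemma same_edge_cases: "fst x = fst y \<Longrightarrow> x = y \<or> x = flip y"
  by (cases x; cases y) (auto simp: flip_def)

lemma source_in_verts: "wf_multigraph G \<Longrightarrow> x \<in> darts G \<Longrightarrow> source G x \<in> verts G"
  by (auto simp: wf_multigraph_def darts_def source_def)

lemma target_in_verts: "wf_multigraph G \<Longrightarrow> x \<in> darts G \<Longrightarrow> target G x \<in> verts G"
  unfolding target_def by (rule source_in_verts) auto

lemma fst_dart_in_edges: "x \<in> darts G \<Longrightarrow> fst x \<in> edges G"
  by (auto simp: darts_def)

text \<open>The graph may be infinite, so sums run over a finite vertex set or over the darts that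
  start in it; an edge inside the set is then met twice, once per orientation.\<close>

locale regular_graph =
  fixes T :: "('t, 'f) multigraph" and d :: nat
  assumes wf: "wf_multigraph T"
    and finite_star: "v \<in> verts T \<Longrightarrow> finite (star T v)"
    and card_star: "v \<in> verts T \<Longrightarrow> card (star T v) = d"
begin

definition darts_from :: "'t set \<Rightarrow> ('f \<times> bool) set" where
  "darts_from K = {x \<in> darts T. source T x \<in> K}"

text \<open>Closed neighbourhood, the range of locality: Jacobi values on \<open>K\<close> read the
  vector on \<open>nbhd K\<close> only, and a vector supported in \<open>K\<close> has its image
  supported in \<open>nbhd K\<close>.\<close>

definition nbhd :: "'t set \<Rightarrow> 't set" where
  "nbhd K = K \<union> target T ` darts_from K"

definition test_function :: "'t set \<Rightarrow> ('t \<Rightarrow> real) \<Rightarrow> bool" where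
  "test_function K u \<longleftrightarrow> finite K \<and> K \<subseteq> verts T \<and> (\<forall>i. i \<notin> K \<longrightarrow> u i = 0)"

lemma darts_from_UN: "darts_from K = (\<Union>v\<in>K. star T v)"
  by (auto simp: darts_from_def star_def)

lemma finite_darts_from: "finite K \<Longrightarrow> K \<subseteq> verts T \<Longrightarrow> finite (darts_from K)"
  unfolding darts_from_UN using finite_star by blast

lemma nbhd:
  assumes "finite K" "K \<subseteq> verts T"
  shows "finite (nbhd K)" "nbhd K \<subseteq> verts T"
  using assms finite_darts_from target_in_verts[OF wf] by (auto simp: nbhd_def darts_from_def)

lemma sum_darts_from:
  assumes "finite K" "K \<subseteq> verts T"
  shows "(\<Sum>v\<in>K. \<Sum>x\<in>star T v. h x) = (\<Sum>x\<in>darts_from K. h x)"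
  unfolding darts_from_UN using assms finite_star
  by (subst sum.UNION_disjoint) (auto simp: star_def)

lemma sum_darts_from_source:
  fixes f :: "'t \<Rightarrow> real"
  assumes "finite K" "K \<subseteq> verts T"
  shows "(\<Sum>x\<in>darts_from K. f (source T x)) = real d * (\<Sum>v\<in>K. f v)"
proof -
  have "(\<Sum>v\<in>K. \<Sum>x\<in>star T v. f (source T x)) = (\<Sum>v\<in>K. real d * f v)"
    using assms card_star by (intro sum.cong) (auto simp: star_def)
  then show ?thesis
    using sum_darts_from[OF assms, of "\<lambda>x. f (source T x)"] by (simp add: sum_distrib_left)
qed

text \<open>Reversal permutes the darts with both ends in \<open>K\<close>, and all other darts
  contribute zero on either side.\<close>

lemma sum_darts_flip:
  fixes h :: "'f \<times> bool \<Rightarrow> real"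
  assumes "finite K" "K \<subseteq> verts T"
    and "\<And>x. x \<in> darts T \<Longrightarrow> h x \<noteq> 0 \<Longrightarrow> source T x \<in> K \<and> target T x \<in> K"
  shows "(\<Sum>x\<in>darts_from K. h x) = (\<Sum>x\<in>darts_from K. h (flip x))"
proof -
  let ?D = "{x \<in> darts T. source T x \<in> K \<and> target T x \<in> K}"
  have fin: "finite (darts_from K)"
    using assms finite_darts_from by blast
  have "(\<Sum>x\<in>darts_from K. h x) = (\<Sum>x\<in>?D. h x)"
    using assms(3) fin by (intro sum.mono_neutral_right) (auto simp: darts_from_def)
  also have "\<dots> = (\<Sum>x\<in>?D. h (flip x))"
    by (rule sum.reindex_bij_witness[of _ flip flip]) auto
  also have "\<dots> = (\<Sum>x\<in>darts_from K. h (flip x))"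
  proof (intro sum.mono_neutral_left)
    show "\<forall>x\<in>darts_from K - ?D. h (flip x) = 0"
      using assms(3)[of "flip x" for x] by (fastforce simp: darts_from_def)
  qed (use fin in \<open>auto simp: darts_from_def\<close>)
  finally show ?thesis .
qed

text \<open>After reversal the darts start in \<open>K\<close>, and each vertex of \<open>K\<close>
  is the source of \<open>d\<close> of them. The bound does not depend on \<open>L\<close>, which
  may therefore exhaust the graph.\<close>

lemma sum_target_sq_le:
  fixes u :: "'t \<Rightarrow> real"
  assumes "finite K" "K \<subseteq> verts T" "finite L" "L \<subseteq> verts T"
    and supp: "\<And>i. i \<notin> K \<Longrightarrow> u i = 0"
  shows "(\<Sum>x\<in>darts_from L. (u (target T x))\<^sup>2) \<le> real d * (\<Sum>v\<in>K. (u v)\<^sup>2)"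
proof -
  let ?D = "{x \<in> darts_from L. target T x \<in> K}"
  have fin: "finite (darts_from L)" "finite (darts_from K)"
    using assms finite_darts_from by blast+
  have "(\<Sum>x\<in>darts_from L. (u (target T x))\<^sup>2) = (\<Sum>x\<in>?D. (u (target T x))\<^sup>2)"
    using supp fin by (intro sum.mono_neutral_right) auto
  also have "\<dots> = (\<Sum>x\<in>flip ` ?D. (u (source T x))\<^sup>2)"
    by (rule sum.reindex_bij_witness[of _ flip flip]) auto
  also have "\<dots> \<le> (\<Sum>x\<in>darts_from K. (u (source T x))\<^sup>2)"
    using fin by (intro sum_mono2) (auto simp: darts_from_def)
  also have "\<dots> = real d * (\<Sum>v\<in>K. (u v)\<^sup>2)"
    using sum_darts_from_source[OF assms(1,2), of "\<lambda>v. (u v)\<^sup>2"] .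
  finally show ?thesis .
qed

lemma jacobi_cong_nbhd:
  assumes "j \<in> K" "\<And>i. i \<in> nbhd K \<Longrightarrow> u i = v i"
  shows "jacobi T a b u j = jacobi T a b v j"
proof -
  have "u (target T x) = v (target T x)" if "x \<in> star T j" for x
    using that assms by (auto simp: nbhd_def darts_from_def star_def)
  moreover have "u j = v j"
    using assms by (auto simp: nbhd_def)
  ultimately show ?thesis
    by (auto simp: jacobi_def)
qed

lemma jacobi_support:
  assumes "K \<subseteq> verts T" "\<And>i. i \<notin> K \<Longrightarrow> u i = 0" "j \<notin> nbhd K"
  shows "jacobi T a b u j = 0"
proof -
  have "target T x \<notin> K" if "x \<in> star T j" for x
  proof
    assume "target T x \<in> K"
    then have "flip x \<in> darts_from K" "target T (flip x) = j"
      using that by (auto simp: darts_from_def star_def)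
    then show False
      using assms(3) by (metis UnI2 imageI nbhd_def)
  qed
  moreover have "j \<notin> K"
    using assms(3) by (auto simp: nbhd_def)
  ultimately show ?thesis
    using assms(2) by (auto simp: jacobi_def intro!: sum.neutral)
qed

text \<open>\<open>u\<close> and \<open>v\<close> are arbitrary off \<open>K\<close>: the ground
  state identity takes for \<open>u\<close> the positive function \<phi>, which is not finitely
  supported.\<close>

lemma sum_mult_jacobi:
  fixes u v :: "'t \<Rightarrow> real"
  assumes "finite K" "K \<subseteq> verts T"
  shows "(\<Sum>j\<in>K. v j * jacobi T a b u j) = (\<Sum>j\<in>K. b j * u j * v j)
    + (\<Sum>x\<in>darts_from K. a (fst x) * v (source T x) * u (target T x))"
proof -
  have "(\<Sum>j\<in>K. v j * jacobi T a b u j) = (\<Sum>j\<in>K. b j * u j * v j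
      + (\<Sum>x\<in>star T j. a (fst x) * v (source T x) * u (target T x)))"
  proof (rule sum.cong)
    fix j assume "j \<in> K"
    then have "j \<in> verts T" using assms by auto
    have "(\<Sum>x\<in>star T j. a (fst x) * v (source T x) * u (target T x))
        = (\<Sum>x\<in>star T j. v j * (a (fst x) * u (target T x)))"
      by (rule sum.cong) (auto simp: star_def)
    then show "v j * jacobi T a b u j = b j * u j * v j
      + (\<Sum>x\<in>star T j. a (fst x) * v (source T x) * u (target T x))"
      using \<open>j \<in> verts T\<close> by (simp add: jacobi_def sum_distrib_left algebra_simps)
  qed simp
  then show ?thesis
    using sum_darts_from[OF assms] by (simp add: sum.distrib)
qed

lemma jacobi_symmetric:
  fixes u v :: "'t \<Rightarrow> real"
  assumes "finite K" "K \<subseteq> verts T"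
    and "\<And>i. i \<notin> K \<Longrightarrow> u i = 0" "\<And>i. i \<notin> K \<Longrightarrow> v i = 0"
  shows "(\<Sum>j\<in>K. v j * jacobi T a b u j) = (\<Sum>j\<in>K. u j * jacobi T a b v j)"
proof -
  have "(\<Sum>x\<in>darts_from K. a (fst x) * v (source T x) * u (target T x))
      = (\<Sum>x\<in>darts_from K. a (fst x) * u (source T x) * v (target T x))"
    using assms(3,4)
    by (subst sum_darts_flip[OF assms(1,2)]) (auto intro!: sum.cong simp: algebra_simps)
  then show ?thesis
    unfolding sum_mult_jacobi[OF assms(1,2)] by (simp add: algebra_simps)
qed

end

section \<open>Boundedness of Jacobi operators with bounded coefficients\<close>

locale bounded_jacobi = regular_graph T d
  for T :: "('t, 'f) multigraph" and d :: nat +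
  fixes a :: "'f \<Rightarrow> real" and b :: "'t \<Rightarrow> real" and A :: real
  assumes a_bound: "e \<in> edges T \<Longrightarrow> \<bar>a e\<bar> \<le> A"
    and b_bound: "v \<in> verts T \<Longrightarrow> \<bar>b v\<bar> \<le> A"
begin

lemma jacobi_sq_le:
  fixes u :: "'t \<Rightarrow> real"
  assumes "j \<in> verts T"
  shows "(jacobi T a b u j)\<^sup>2
    \<le> 2 * A\<^sup>2 * ((u j)\<^sup>2 + real d * (\<Sum>x\<in>star T j. (u (target T x))\<^sup>2))"
proof -
  have sq: "c\<^sup>2 \<le> A\<^sup>2" if "\<bar>c\<bar> \<le> A" for c
    using that power_mono[of "\<bar>c\<bar>" A 2] by simp
  have "(\<Sum>x\<in>star T j. a (fst x) * u (target T x))\<^sup>2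
      \<le> (\<Sum>x\<in>star T j. (a (fst x))\<^sup>2) * (\<Sum>x\<in>star T j. (u (target T x))\<^sup>2)"
    by (rule Cauchy_Schwarz_ineq_sum)
  also have "\<dots> \<le> (real d * A\<^sup>2) * (\<Sum>x\<in>star T j. (u (target T x))\<^sup>2)"
  proof (rule mult_right_mono)
    have "(\<Sum>x\<in>star T j. (a (fst x))\<^sup>2) \<le> (\<Sum>x\<in>star T j. A\<^sup>2)"
      by (intro sum_mono sq a_bound) (auto simp: star_def darts_def)
    then show "(\<Sum>x\<in>star T j. (a (fst x))\<^sup>2) \<le> real d * A\<^sup>2"
      using card_star[OF assms] by simp
  qed (simp add: sum_nonneg)
  finally have 1: "(\<Sum>x\<in>star T j. a (fst x) * u (target T x))\<^sup>2
      \<le> (real d * A\<^sup>2) * (\<Sum>x\<in>star T j. (u (target T x))\<^sup>2)" .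
  have 2: "(b j * u j)\<^sup>2 \<le> A\<^sup>2 * (u j)\<^sup>2"
    unfolding power_mult_distrib by (intro mult_right_mono sq b_bound assms) simp
  have 3: "(y + z)\<^sup>2 \<le> 2 * y\<^sup>2 + 2 * z\<^sup>2" for y z :: real
    using zero_le_power2[of "y - z"] by (simp add: power2_eq_square algebra_simps)
  show ?thesis
    using 1 2 3[of "b j * u j" "\<Sum>x\<in>star T j. a (fst x) * u (target T x)"] assms
    by (simp add: jacobi_def algebra_simps)
qed

text \<open>Cauchy-Schwarz over the \<open>d\<close> darts at each vertex gives one factor
  \<open>d\<close>, and counting each value of \<open>u\<close> once per neighbour gives the
  other.\<close>

lemma jacobi_norm_bound:
  fixes u :: "'t \<Rightarrow> real"
  assumes "finite K" "K \<subseteq> verts T" "finite L" "L \<subseteq> verts T" and supp: "\<And>i. i \<notin> K \<Longrightarrow> u i = 0"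
  shows "(\<Sum>j\<in>L. (jacobi T a b u j)\<^sup>2) \<le> 2 * A\<^sup>2 * (1 + (real d)\<^sup>2) * (\<Sum>j\<in>K. (u j)\<^sup>2)"
proof -
  have "(\<Sum>j\<in>L. (jacobi T a b u j)\<^sup>2)
      \<le> (\<Sum>j\<in>L. 2 * A\<^sup>2 * ((u j)\<^sup>2 + real d * (\<Sum>x\<in>star T j. (u (target T x))\<^sup>2)))"
    using assms(4) by (intro sum_mono jacobi_sq_le) auto
  also have "\<dots> = 2 * A\<^sup>2 * ((\<Sum>j\<in>L. (u j)\<^sup>2) + real d * (\<Sum>x\<in>darts_from L. (u (target T x))\<^sup>2))"
    using sum_darts_from[OF assms(3,4), of "\<lambda>x. (u (target T x))\<^sup>2"]
    by (simp add: sum.distrib flip: sum_distrib_left)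
  also have "\<dots> \<le> 2 * A\<^sup>2 * ((\<Sum>j\<in>K. (u j)\<^sup>2) + real d * (real d * (\<Sum>j\<in>K. (u j)\<^sup>2)))"
  proof (intro mult_left_mono add_mono)
    have "(\<Sum>j\<in>L. (u j)\<^sup>2) = (\<Sum>j\<in>L \<inter> K. (u j)\<^sup>2)"
      using supp assms(3) by (intro sum.mono_neutral_right) auto
    also have "\<dots> \<le> (\<Sum>j\<in>K. (u j)\<^sup>2)"
      using assms(1) by (intro sum_mono2) auto
    finally show "(\<Sum>j\<in>L. (u j)\<^sup>2) \<le> (\<Sum>j\<in>K. (u j)\<^sup>2)" .
  qed (use sum_target_sq_le[OF assms] in auto)
  finally show ?thesis
    by (simp add: power2_eq_square algebra_simps)
qed

end

section \<open>The top of the spectrum\<close>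

text \<open>Membership and norm are both read off from finite sections, which reduces estimates on
  \<open>ell2\<close> to estimates over finite sets.\<close>

lemma ell2I:
  assumes "\<And>i. i \<notin> V \<Longrightarrow> u i = 0"
    and bound: "\<And>F. finite F \<Longrightarrow> F \<subseteq> V \<Longrightarrow> L2_set (\<lambda>i. cmod (u i)) F \<le> C"
  shows "u \<in> ell2 V" "ell2_norm V u \<le> C"
proof -
  have C: "0 \<le> C"
    using bound[of "{}"] by simp
  have fin: "(\<Sum>i\<in>F. (cmod (u i))\<^sup>2) \<le> C\<^sup>2" if "finite F" "F \<subseteq> V" for F
    using bound[OF that] C by (simp add: L2_set_def real_sqrt_le_iff sqrt_le_D)
  have summ: "(\<lambda>i. (cmod (u i))\<^sup>2) summable_on V"
    using fin by (intro nonneg_bdd_above_summable_on bdd_aboveI2[of _ _ "C\<^sup>2"]) auto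
  then show "u \<in> ell2 V"
    using assms(1) by (simp add: ell2_def)
  have "(\<Sum>\<^sub>\<infinity>i\<in>V. (cmod (u i))\<^sup>2) \<le> C\<^sup>2"
    using summ fin by (rule infsum_le_finite_sums)
  then show "ell2_norm V u \<le> C"
    using C by (simp add: ell2_norm_def real_le_lsqrt)
qed

lemma L2_set_le_ell2_norm:
  assumes "u \<in> ell2 V" "finite F" "F \<subseteq> V"
  shows "L2_set (\<lambda>i. cmod (u i)) F \<le> ell2_norm V u"
  using assms unfolding L2_set_def ell2_norm_def
  by (intro real_sqrt_le_mono finite_sum_le_infsum) (auto simp: ell2_def)

lemma cmod_le_ell2_norm:
  assumes "u \<in> ell2 V"
  shows "cmod (u i) \<le> ell2_norm V u"
proof (cases "i \<in> V")
  case True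
  then show ?thesis
    using L2_set_le_ell2_norm[OF assms, of "{i}"] by simp
next
  case False
  then show ?thesis
    using assms L2_set_le_ell2_norm[OF assms, of "{}"] by (simp add: ell2_def)
qed

lemma ell2_norm_nonneg: "0 \<le> ell2_norm V u"
  by (simp add: ell2_norm_def infsum_nonneg)

lemma ell2_scale:
  assumes "u \<in> ell2 V"
  shows "(\<lambda>i. c * u i) \<in> ell2 V" "ell2_norm V (\<lambda>i. c * u i) \<le> cmod c * ell2_norm V u"
proof -
  have *: "L2_set (\<lambda>i. cmod (c * u i)) F \<le> cmod c * ell2_norm V u" if "finite F" "F \<subseteq> V" for F
  proof -
    have "L2_set (\<lambda>i. cmod (c * u i)) F = cmod c * L2_set (\<lambda>i. cmod (u i)) F"
      by (simp add: norm_mult L2_set_right_distrib)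
    then show ?thesis
      using L2_set_le_ell2_norm[OF assms that] by (simp add: mult_left_mono)
  qed
  have "c * u i = 0" if "i \<notin> V" for i
    using that assms by (simp add: ell2_def)
  then show "(\<lambda>i. c * u i) \<in> ell2 V" "ell2_norm V (\<lambda>i. c * u i) \<le> cmod c * ell2_norm V u"
    using ell2I[of V "\<lambda>i. c * u i", OF _ *] by auto
qed

lemma ell2_add:
  assumes "u \<in> ell2 V" "v \<in> ell2 V"
  shows "(\<lambda>i. u i + v i) \<in> ell2 V" "ell2_norm V (\<lambda>i. u i + v i) \<le> ell2_norm V u + ell2_norm V v"
proof -
  have *: "L2_set (\<lambda>i. cmod (u i + v i)) F \<le> ell2_norm V u + ell2_norm V v"
    if "finite F" "F \<subseteq> V" for F
  proof -
    have "L2_set (\<lambda>i. cmod (u i + v i)) F \<le> L2_set (\<lambda>i. cmod (u i) + cmod (v i)) F"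
      by (intro L2_set_mono norm_triangle_ineq) auto
    also have "\<dots> \<le> L2_set (\<lambda>i. cmod (u i)) F + L2_set (\<lambda>i. cmod (v i)) F"
      by (rule L2_set_triangle_ineq)
    finally show ?thesis
      using L2_set_le_ell2_norm[OF assms(1) that] L2_set_le_ell2_norm[OF assms(2) that] by simp
  qed
  have "u i + v i = 0" if "i \<notin> V" for i
    using that assms by (simp add: ell2_def)
  then show "(\<lambda>i. u i + v i) \<in> ell2 V"
    "ell2_norm V (\<lambda>i. u i + v i) \<le> ell2_norm V u + ell2_norm V v"
    using ell2I[of V "\<lambda>i. u i + v i", OF _ *] by auto
qed

section \<open>Inverting the shifted operator by iteration\<close>

context bounded_jacobi
begin

text \<open>One step of Richardson iteration, \<open>B = 1 + t (J - x)\<close>. The scalars stay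
  open because contraction is shown for real vectors and the resolvent concerns complex
  ones.\<close>

definition relax :: "real \<Rightarrow> real \<Rightarrow> ('t \<Rightarrow> 'c::real_vector) \<Rightarrow> 't \<Rightarrow> 'c" where
  "relax t x u j = u j + t *\<^sub>R (jacobi T a b u j - x *\<^sub>R u j)"

text \<open>The image is measured on an arbitrary finite \<open>L\<close>, independent of the
  support \<open>K\<close>, so that the bound passes to all of \<open>ell2\<close>.\<close>

definition relax_contracts :: "real \<Rightarrow> real \<Rightarrow> real \<Rightarrow> bool" where
  "relax_contracts t x r \<longleftrightarrow> (\<forall>K L u. test_function K u \<longrightarrow> finite L \<longrightarrow> L \<subseteq> verts T \<longrightarrow>
     (\<Sum>i\<in>L. (relax t x u i)\<^sup>2) \<le> r\<^sup>2 * (\<Sum>i\<in>K. (u i)\<^sup>2))"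

lemma Re_relax: "Re (relax t x u j) = relax t x (\<lambda>i. Re (u i)) j"
  by (simp add: relax_def jacobi_def)

lemma Im_relax: "Im (relax t x u j) = relax t x (\<lambda>i. Im (u i)) j"
  by (simp add: relax_def jacobi_def)

lemma relax_cong_nbhd:
  assumes "j \<in> K" "\<And>i. i \<in> nbhd K \<Longrightarrow> u i = v i"
  shows "relax t x u j = relax t x v j"
  using jacobi_cong_nbhd[OF assms] assms by (simp add: relax_def nbhd_def)

text \<open>By locality \<open>u\<close> may be cut off outside \<open>nbhd L\<close> without
  changing the values on \<open>L\<close>. The coefficients being real, real and imaginary parts are
  estimated separately.\<close>

lemma relax_ell2:
  assumes contr: "relax_contracts t x r"
    and "0 \<le> r" and u: "u \<in> ell2 (verts T)"
  shows "relax t x u \<in> ell2 (verts T)"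
    and "ell2_norm (verts T) (relax t x u) \<le> r * ell2_norm (verts T) u"
proof -
  have *: "L2_set (\<lambda>i. cmod (relax t x u i)) L \<le> r * ell2_norm (verts T) u"
    if L: "finite L" "L \<subseteq> verts T" for L
  proof -
    define K where "K = nbhd L"
    have K: "finite K" "K \<subseteq> verts T"
      using nbhd[OF L] by (auto simp: K_def)
    define v where "v = (\<lambda>i. if i \<in> K then u i else 0)"
    have eq: "relax t x u i = relax t x v i" if "i \<in> L" for i
      using that by (intro relax_cong_nbhd) (auto simp: v_def K_def)
    have "(\<Sum>i\<in>L. (cmod (relax t x u i))\<^sup>2)
        = (\<Sum>i\<in>L. (relax t x (\<lambda>i. Re (v i)) i)\<^sup>2) + (\<Sum>i\<in>L. (relax t x (\<lambda>i. Im (v i)) i)\<^sup>2)"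
      unfolding sum.distrib[symmetric]
      by (intro sum.cong) (auto simp: eq cmod_power2 Re_relax Im_relax)
    also have "\<dots> \<le> r\<^sup>2 * (\<Sum>i\<in>K. (Re (v i))\<^sup>2) + r\<^sup>2 * (\<Sum>i\<in>K. (Im (v i))\<^sup>2)"
      by (intro add_mono contr[unfolded relax_contracts_def, rule_format] L)
        (use K in \<open>auto simp: test_function_def v_def\<close>)
    also have "\<dots> = r\<^sup>2 * (\<Sum>i\<in>K. (cmod (u i))\<^sup>2)"
      by (simp add: cmod_power2 sum.distrib v_def distrib_left)
    finally have "L2_set (\<lambda>i. cmod (relax t x u i)) L \<le> sqrt (r\<^sup>2 * (\<Sum>i\<in>K. (cmod (u i))\<^sup>2))"
      unfolding L2_set_def by (rule real_sqrt_le_mono)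
    also have "\<dots> = r * L2_set (\<lambda>i. cmod (u i)) K"
      using \<open>0 \<le> r\<close> by (simp add: real_sqrt_mult L2_set_def)
    also have "\<dots> \<le> r * ell2_norm (verts T) u"
      by (intro mult_left_mono L2_set_le_ell2_norm u K \<open>0 \<le> r\<close>)
    finally show ?thesis .
  qed
  have "relax t x u i = 0" if "i \<notin> verts T" for i
    using that u by (simp add: relax_def jacobi_def ell2_def)
  then show "relax t x u \<in> ell2 (verts T)"
    "ell2_norm (verts T) (relax t x u) \<le> r * ell2_norm (verts T) u"
    using ell2I[of "verts T" "relax t x u", OF _ *] by auto
qed

lemma jacobi_sums:
  fixes f :: "nat \<Rightarrow> 't \<Rightarrow> complex"
  assumes "\<And>i. (\<lambda>n. f n i) sums u i"
  shows "(\<lambda>n. jacobi T a b (f n) j) sums jacobi T a b u j"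
  unfolding jacobi_def using assms
  by (auto intro!: sums_add sums_scaleR_right sums_sum)

text \<open>The Neumann series \<open>\<Sum>n. B\<^sup>n w\<close> of the contraction \<open>B = relax t x\<close> is summed
  pointwise; as the Jacobi operator is local, it may be applied termwise.\<close>

lemma relax_contraction_resolvent:
  assumes contr: "relax_contracts t x r"
    and r: "0 \<le> r" "r < 1" and t: "0 < t"
  shows "complex_of_real x \<in> resolvent_set (verts T) (jacobi T a b)"
proof -
  let ?V = "verts T"
  let ?R = "\<lambda>u i. jacobi T a b u i - complex_of_real x * u i"
  note relax = relax_ell2[OF contr r(1)]
  have relax_eq: "relax t x u i = u i + of_real t * ?R u i" for u i
    by (simp add: relax_def scaleR_conv_of_real)
  have R_eq: "?R u = (\<lambda>i. of_real (1 / t) * (relax t x u i + (-1) * u i))" for u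
    using t by (auto simp: relax_eq)
  have R_in: "?R u \<in> ell2 ?V" if "u \<in> ell2 ?V" for u
    unfolding R_eq by (intro ell2_scale(1) ell2_add(1) relax(1) that)
  have bound: "ell2_norm ?V u \<le> t / (1 - r) * ell2_norm ?V (?R u)" if u: "u \<in> ell2 ?V" for u
  proof -
    have "ell2_norm ?V u = ell2_norm ?V (\<lambda>i. relax t x u i + (- of_real t) * ?R u i)"
      by (simp add: relax_eq)
    also have "\<dots> \<le> ell2_norm ?V (relax t x u) + ell2_norm ?V (\<lambda>i. (- of_real t) * ?R u i)"
      by (intro ell2_add relax ell2_scale R_in u)
    also have "\<dots> \<le> r * ell2_norm ?V u + cmod (- of_real t) * ell2_norm ?V (?R u)"
      by (intro add_mono relax ell2_scale R_in u)
    finally have "(1 - r) * ell2_norm ?V u \<le> t * ell2_norm ?V (?R u)"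
      using t by (simp add: algebra_simps)
    then show ?thesis
      using r by (simp add: field_simps)
  qed
  have R_diff: "?R (\<lambda>i. u i + (-1) * v i) = (\<lambda>i. ?R u i - ?R v i)" for u v
  proof
    fix i
    have "(\<Sum>x\<in>star T i. a (fst x) *\<^sub>R (u (target T x) + (-1) * v (target T x)))
        = (\<Sum>x\<in>star T i. a (fst x) *\<^sub>R u (target T x))
          - (\<Sum>x\<in>star T i. a (fst x) *\<^sub>R v (target T x))"
      by (simp add: scaleR_diff_right sum_subtractf)
    then show "?R (\<lambda>i. u i + (-1) * v i) i = ?R u i - ?R v i"
      by (simp add: jacobi_def algebra_simps)
  qed
  have inj: "inj_on ?R (ell2 ?V)"
  proof (rule inj_onI)
    fix u v assume u: "u \<in> ell2 ?V" and v: "v \<in> ell2 ?V" and eq: "?R u = ?R v"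
    define w where "w = (\<lambda>i. u i + (-1) * v i)"
    have w: "w \<in> ell2 ?V"
      unfolding w_def by (intro ell2_add ell2_scale u v)
    have "?R w = (\<lambda>i. 0)"
      unfolding w_def R_diff using fun_cong[OF eq] by simp
    then have "ell2_norm ?V (?R w) = 0"
      by (simp add: ell2_norm_def)
    then have "ell2_norm ?V w \<le> 0"
      using bound[OF w] by simp
    then have "cmod (w i) \<le> 0" for i
      using cmod_le_ell2_norm[OF w, of i] by linarith
    then show "u = v"
      by (auto simp: w_def)
  qed
  have surj: "w \<in> ?R ` ell2 ?V" if w: "w \<in> ell2 ?V" for w
  proof -
    \<comment> \<open>Since \<open>1 - B = - t (J - x)\<close>, solving \<open>(J - x) s = w\<close>
      means solving \<open>(1 - B) s = - t w\<close>.\<close>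
    define w' where "w' = (\<lambda>i. - of_real t * w i)"
    have w': "w' \<in> ell2 ?V"
      unfolding w'_def by (intro ell2_scale w)
    define f where "f n = (relax t x ^^ n) w'" for n
    have f_Suc: "f (Suc n) = relax t x (f n)" for n
      by (simp add: f_def)
    have f: "f n \<in> ell2 ?V \<and> ell2_norm ?V (f n) \<le> r ^ n * ell2_norm ?V w'" for n
    proof (induction n)
      case 0
      show ?case using w' by (simp add: f_def)
    next
      case (Suc n)
      have "ell2_norm ?V (f (Suc n)) \<le> r * ell2_norm ?V (f n)"
        unfolding f_Suc using Suc by (intro relax) auto
      also have "\<dots> \<le> r * (r ^ n * ell2_norm ?V w')"
        using Suc r by (intro mult_left_mono) auto
      finally show ?case
        using Suc relax(1) by (simp add: f_Suc)
    qed
    have f_le: "cmod (f n i) \<le> ell2_norm ?V w' * r ^ n" for n i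
      using cmod_le_ell2_norm[of "f n" ?V i] f[of n] by (simp add: mult.commute)
    have geo: "summable (\<lambda>n. ell2_norm ?V w' * r ^ n)"
      using r by (intro summable_mult summable_geometric) auto
    have summ: "summable (\<lambda>n. f n i)" for i
      using f_le by (intro summable_comparison_test'[OF geo]) auto
    define s where "s i = (\<Sum>n. f n i)" for i
    have s: "(\<lambda>n. f n i) sums s i" for i
      using summ by (simp add: s_def summable_sums)
    have "s \<in> ell2 ?V"
    proof (rule ell2I(1))
      fix i assume "i \<notin> ?V"
      then have "f n i = 0" for n
        using f by (simp add: ell2_def)
      then show "s i = 0"
        by (simp add: s_def)
    next
      fix F assume F: "finite F" "F \<subseteq> ?V"
      have "L2_set (\<lambda>i. cmod (\<Sum>k<n. f k i)) F \<le> (\<Sum>k<n. ell2_norm ?V w' * r ^ k)" for n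
      proof (induction n)
        case 0
        show ?case by (simp add: L2_set_def)
      next
        case (Suc n)
        have "L2_set (\<lambda>i. cmod (\<Sum>k<Suc n. f k i)) F
            \<le> L2_set (\<lambda>i. cmod (\<Sum>k<n. f k i) + cmod (f n i)) F"
          by (intro L2_set_mono) (auto intro: norm_triangle_ineq)
        also have "\<dots> \<le> L2_set (\<lambda>i. cmod (\<Sum>k<n. f k i)) F + L2_set (\<lambda>i. cmod (f n i)) F"
          by (rule L2_set_triangle_ineq)
        finally show ?case
          using Suc L2_set_le_ell2_norm[of "f n" ?V F] f[of n] F by (simp add: mult.commute)
      qed
      also have "(\<Sum>k<n. ell2_norm ?V w' * r ^ k) \<le> (\<Sum>k. ell2_norm ?V w' * r ^ k)" for n
        using geo r by (intro sum_le_suminf) (auto simp: ell2_norm_nonneg)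
      finally have le: "L2_set (\<lambda>i. cmod (\<Sum>k<n. f k i)) F \<le> (\<Sum>k. ell2_norm ?V w' * r ^ k)" for n .
      have "(\<lambda>n. L2_set (\<lambda>i. cmod (\<Sum>k<n. f k i)) F) \<longlonglongrightarrow> L2_set (\<lambda>i. cmod (s i)) F"
        unfolding L2_set_def using s by (intro tendsto_intros) (simp add: sums_def)
      then show "L2_set (\<lambda>i. cmod (s i)) F \<le> (\<Sum>k. ell2_norm ?V w' * r ^ k)"
        using le by (intro LIMSEQ_le_const2) auto
    qed
    have "?R s i = w i" for i
    proof -
      have "(\<lambda>n. ?R (f n) i) sums ?R s i"
        by (intro sums_diff sums_mult jacobi_sums s)
      \<comment> \<open>As \<open>t (J - x) f_n = f_(n+1) - f_n\<close>, the series telescopes; only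
        the first term survives, because the terms of a convergent series tend to zero.\<close>
      moreover have "(\<lambda>n. of_real (1 / t) * (f (Suc n) i - f n i)) sums (of_real (1 / t) * (0 - f 0 i))"
        by (intro sums_mult telescope_sums summable_LIMSEQ_zero summ)
      moreover have "of_real (1 / t) * (0 - f 0 i) = w i"
        using t by (simp add: f_def w'_def)
      moreover have "(\<lambda>n. ?R (f n) i) = (\<lambda>n. of_real (1 / t) * (f (Suc n) i - f n i))"
        using t by (simp add: f_Suc relax_eq)
      ultimately have "(\<lambda>n. ?R (f n) i) sums ?R s i" "(\<lambda>n. ?R (f n) i) sums w i"
        by (simp_all only:)
      then show ?thesis
        by (rule sums_unique2)
    qed
    then have "?R s = w"
      by (rule ext)
    then show ?thesis
      using \<open>s \<in> ell2 ?V\<close> by (intro image_eqI[of _ _ s]) simp_all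
  qed
  have "?R ` ell2 ?V = ell2 ?V"
  proof
    show "?R ` ell2 ?V \<subseteq> ell2 ?V"
      by (rule image_subsetI) (rule R_in)
    show "ell2 ?V \<subseteq> ?R ` ell2 ?V"
      by (rule subsetI) (rule surj)
  qed
  then have "bij_betw ?R (ell2 ?V) (ell2 ?V)"
    unfolding bij_betw_def using inj by (rule conjI[rotated])
  then show ?thesis
    unfolding resolvent_set_def
    by (intro CollectI conjI exI[of _ "t / (1 - r)"] ballI bound)
qed

section \<open>Rayleigh quotients and the top of the spectrum\<close>

definition form_le :: "real \<Rightarrow> bool" where
  "form_le M \<longleftrightarrow> (\<forall>K u. test_function K u \<longrightarrow>
     (\<Sum>i\<in>K. u i * jacobi T a b u i) \<le> M * (\<Sum>i\<in>K. (u i)\<^sup>2))"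

text \<open>Together with \<open>form_le M\<close> this says that \<open>M\<close> is the supremum
  of the Rayleigh quotients. The two are kept apart because the ground state substitution proves
  each of them for a different constant.\<close>

definition form_approx :: "real \<Rightarrow> bool" where
  "form_approx M \<longleftrightarrow> (\<forall>\<epsilon>>0. \<exists>K u. test_function K u \<and> (\<Sum>i\<in>K. (u i)\<^sup>2) > 0 \<and>
     (\<Sum>i\<in>K. u i * jacobi T a b u i) \<ge> (M - \<epsilon>) * (\<Sum>i\<in>K. (u i)\<^sup>2))"

lemma form_bound: "form_le (1 + 2 * A\<^sup>2 * (1 + (real d)\<^sup>2))"
  unfolding form_le_def
proof (intro allI impI)
  fix K and u :: "'t \<Rightarrow> real" assume u: "test_function K u"
  have xy: "y * z \<le> y\<^sup>2 + z\<^sup>2" for y z :: real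
    using sum_squares_bound[of y z] zero_le_power2[of y] zero_le_power2[of z] by linarith
  have "(\<Sum>i\<in>K. u i * jacobi T a b u i) \<le> (\<Sum>i\<in>K. (u i)\<^sup>2 + (jacobi T a b u i)\<^sup>2)"
    by (intro sum_mono xy)
  also have "\<dots> \<le> (\<Sum>i\<in>K. (u i)\<^sup>2) + 2 * A\<^sup>2 * (1 + (real d)\<^sup>2) * (\<Sum>i\<in>K. (u i)\<^sup>2)"
    using jacobi_norm_bound[of K K u] u by (simp add: sum.distrib test_function_def)
  finally show "(\<Sum>i\<in>K. u i * jacobi T a b u i)
      \<le> (1 + 2 * A\<^sup>2 * (1 + (real d)\<^sup>2)) * (\<Sum>i\<in>K. (u i)\<^sup>2)"
    by (simp add: algebra_simps)
qed

lemma ex_form_sup: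
  assumes "verts T \<noteq> {}"
  shows "\<exists>M. form_le M \<and> form_approx M"
proof -
  let ?N = "\<lambda>K u. \<Sum>i\<in>K. (u i :: real)\<^sup>2"
  let ?q = "\<lambda>K u. \<Sum>i\<in>K. u i * jacobi T a b u i"
  define X where "X = {?q K u / ?N K u | K u. test_function K u \<and> ?N K u > 0}"
  obtain r where r: "r \<in> verts T"
    using assms by blast
  have "test_function {r} (\<lambda>i. if i = r then 1 else 0)"
    using r by (simp add: test_function_def)
  then have ne: "X \<noteq> {}"
    unfolding X_def by fastforce
  have bdd: "bdd_above X"
    using form_bound by (fastforce simp: X_def form_le_def bdd_above_def divide_le_eq)
  have "form_le (Sup X)"
    unfolding form_le_def
  proof (intro allI impI)
    fix K u assume u: "test_function K u"
    show "?q K u \<le> Sup X * ?N K u"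
    proof (cases "?N K u > 0")
      case True
      then have "?q K u / ?N K u \<le> Sup X"
        using u by (intro cSup_upper bdd) (auto simp: X_def)
      then show ?thesis
        using True by (simp add: divide_le_eq)
    next
      case False
      then have 0: "?N K u = 0"
        by (meson antisym not_le sum_nonneg zero_le_power2)
      then have "\<forall>i\<in>K. u i = 0"
        using u by (auto simp: test_function_def sum_nonneg_eq_0_iff)
      then show ?thesis
        using 0 by simp
    qed
  qed
  moreover have "form_approx (Sup X)"
    unfolding form_approx_def
  proof (intro allI impI)
    fix \<epsilon> :: real assume "\<epsilon> > 0"
    then obtain y where "y \<in> X" "Sup X - \<epsilon> < y"
      using less_cSup_iff[OF ne bdd, of "Sup X - \<epsilon>"] by auto
    then obtain K u where "test_function K u" "?N K u > 0" "Sup X - \<epsilon> < ?q K u / ?N K u"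
      unfolding X_def by blast
    then show "\<exists>K u. test_function K u \<and> ?N K u > 0 \<and> ?q K u \<ge> (Sup X - \<epsilon>) * ?N K u"
      by (intro exI[of _ K] exI[of _ u]) (auto simp: less_divide_eq)
  qed
  ultimately show ?thesis
    by blast
qed

text \<open>The form of \<open>J - x\<close> is at most \<open>- c\<close> with
  \<open>c = x - M > 0\<close>, and \<open>J - x\<close> is bounded, so a short step along
  \<open>(J - x) u\<close> shrinks every \<open>u\<close> by a uniform factor.\<close>

lemma coercive_resolvent:
  assumes form: "form_le M" and x: "M < x"
  shows "complex_of_real x \<in> resolvent_set (verts T) (jacobi T a b)"
proof -
  define c where "c = x - M"
  \<comment> \<open>The last two summands bound the squared norm of \<open>J - x\<close>; the
    summand \<open>c^2\<close> makes \<open>c^2 / C\<close> at most 1, so that the root in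
    \<open>r\<close> is real.\<close>
  define C where "C = c\<^sup>2 + 2 * (2 * A\<^sup>2 * (1 + (real d)\<^sup>2)) + 2 * x\<^sup>2"
  have c: "c > 0" using x by (simp add: c_def)
  have C: "C > 0" "c\<^sup>2 \<le> C"
    using c by (auto simp: C_def intro!: add_pos_nonneg add_nonneg_nonneg)
  \<comment> \<open>This minimizes the squared contraction factor \<open>1 - 2 t c + t^2 C\<close>,
    with minimum \<open>1 - c^2 / C\<close>.\<close>
  define t where "t = c / C"
  define r where "r = sqrt (1 - c\<^sup>2 / C)"
  have t: "t > 0" using c C by (simp add: t_def)
  have r: "0 \<le> r" "r < 1" "r\<^sup>2 = 1 - c\<^sup>2 / C"
    using c C by (auto simp: r_def divide_le_eq)
  have contr: "(\<Sum>i\<in>L. (relax t x u i)\<^sup>2) \<le> r\<^sup>2 * (\<Sum>i\<in>K. (u i)\<^sup>2)"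
    if K: "finite K" "K \<subseteq> verts T" and L: "finite L" "L \<subseteq> verts T"
      and supp: "\<And>i. i \<notin> K \<Longrightarrow> u i = 0" for K L and u :: "'t \<Rightarrow> real"
  proof -
    let ?R = "\<lambda>i. jacobi T a b u i - x * u i"
    define N where "N = (\<Sum>i\<in>K. (u i)\<^sup>2)"
    define F where "F = K \<union> L"
    have F: "finite F" "F \<subseteq> verts T" "K \<subseteq> F" "L \<subseteq> F"
      using K L by (auto simp: F_def)
    have NF: "(\<Sum>i\<in>F. (u i)\<^sup>2) = N"
      unfolding N_def using supp F by (intro sum.mono_neutral_right) auto
    have cross: "(\<Sum>i\<in>F. u i * ?R i) \<le> - c * N"
    proof -
      have "(\<Sum>i\<in>F. u i * ?R i) = (\<Sum>i\<in>K. u i * ?R i)"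
        using supp F by (intro sum.mono_neutral_right) auto
      also have "\<dots> = (\<Sum>i\<in>K. u i * jacobi T a b u i) - x * N"
        by (simp add: N_def sum_distrib_left right_diff_distrib sum_subtractf power2_eq_square
            mult.left_commute)
      also have "\<dots> \<le> - c * N"
        using form K supp by (simp add: form_le_def test_function_def N_def c_def algebra_simps)
      finally show ?thesis .
    qed
    have sq: "(\<Sum>i\<in>F. (?R i)\<^sup>2) \<le> C * N"
    proof -
      have 3: "(y - z)\<^sup>2 \<le> 2 * y\<^sup>2 + 2 * z\<^sup>2" for y z :: real
        using zero_le_power2[of "y + z"] by (simp add: power2_eq_square algebra_simps)
      have "(\<Sum>i\<in>F. (?R i)\<^sup>2) \<le> (\<Sum>i\<in>F. 2 * (jacobi T a b u i)\<^sup>2 + 2 * (x * u i)\<^sup>2)"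
        by (intro sum_mono 3)
      also have "\<dots> = 2 * (\<Sum>i\<in>F. (jacobi T a b u i)\<^sup>2) + 2 * x\<^sup>2 * N"
        by (simp add: sum.distrib power_mult_distrib sum_distrib_left mult.assoc flip: NF)
      also have "\<dots> \<le> 2 * (2 * A\<^sup>2 * (1 + (real d)\<^sup>2) * N) + 2 * x\<^sup>2 * N"
        using jacobi_norm_bound[OF K F(1,2), of u] supp by (simp add: N_def)
      also have "\<dots> \<le> C * N"
        by (simp add: C_def algebra_simps N_def sum_nonneg)
      finally show ?thesis .
    qed
    have "(\<Sum>i\<in>L. (relax t x u i)\<^sup>2) \<le> (\<Sum>i\<in>F. (relax t x u i)\<^sup>2)"
      using F by (intro sum_mono2) auto
    also have "\<dots> = (\<Sum>i\<in>F. (u i)\<^sup>2 + 2 * t * (u i * ?R i) + t\<^sup>2 * (?R i)\<^sup>2)"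
      by (intro sum.cong) (auto simp: relax_def power2_eq_square algebra_simps)
    also have "\<dots> = N + 2 * t * (\<Sum>i\<in>F. u i * ?R i) + t\<^sup>2 * (\<Sum>i\<in>F. (?R i)\<^sup>2)"
      by (simp add: sum.distrib NF flip: sum_distrib_left)
    also have "\<dots> \<le> N + 2 * t * (- c * N) + t\<^sup>2 * (C * N)"
      using cross sq t by (intro add_mono mult_left_mono) auto
    also have "\<dots> = r\<^sup>2 * N"
      using C unfolding r(3) by (simp add: t_def field_simps power2_eq_square)
    finally show ?thesis
      by (simp add: N_def)
  qed
  have "relax_contracts t x r"
    unfolding relax_contracts_def test_function_def by (intro allI impI contr) auto
  then show ?thesis
    by (rule relax_contraction_resolvent[OF _ r(1,2) t])
qed

lemma jacobi_diff_scale: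
  fixes u v :: "'t \<Rightarrow> real"
  shows "jacobi T a b (\<lambda>i. u i - s * v i) j = jacobi T a b u j - s * jacobi T a b v j"
proof -
  have "(\<Sum>x\<in>star T j. a (fst x) * (u (target T x) - s * v (target T x)))
      = (\<Sum>x\<in>star T j. a (fst x) * u (target T x)) - s * (\<Sum>x\<in>star T j. a (fst x) * v (target T x))"
    by (simp add: right_diff_distrib sum_subtractf sum_distrib_left mult.left_commute)
  then show ?thesis
    by (simp add: jacobi_def algebra_simps)
qed

text \<open>For a positive operator \<open>0 \<le> P \<le> \<kappa>\<close> one has \<open>P\<^sup>2 \<le> \<kappa> P\<close>; this is read off from
  \<open>\<langle>P v, v\<rangle> \<ge> 0\<close> at \<open>v = u - P u / \<kappa>\<close>, for \<open>P\<close> the difference of \<open>M\<close> and the Jacobi operator.\<close>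

lemma residual_le_form:
  assumes form: "form_le M"
  obtains \<kappa> where "\<kappa> > 0" "\<And>K L u. test_function K u \<Longrightarrow> finite L \<Longrightarrow> L \<subseteq> verts T \<Longrightarrow>
    (\<Sum>i\<in>L. (jacobi T a b u i - M * u i)\<^sup>2)
      \<le> \<kappa> * (M * (\<Sum>i\<in>K. (u i)\<^sup>2) - (\<Sum>i\<in>K. u i * jacobi T a b u i))"
proof -
  define K2 where "K2 = 2 * A\<^sup>2 * (1 + (real d)\<^sup>2)"
  have K2: "K2 \<ge> 0" by (simp add: K2_def)
  \<comment> \<open>An upper bound for the form of \<open>P\<close>: \<bar>M\<bar> comes from the
    multiple of the identity, and \<open>1 + K2\<close> from \<open>- y z \<le> y^2 + z^2\<close>
    applied to the Jacobi part.\<close>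
  define \<kappa> where "\<kappa> = \<bar>M\<bar> + 1 + K2"
  have \<kappa>: "\<kappa> > 0" using K2 by (simp add: \<kappa>_def)
  define q where "q F v = (\<Sum>i\<in>F. v i * (M * v i - jacobi T a b v i))" for F v
  have q_nonneg: "q F v \<ge> 0" if "test_function F v" for F v
    using form that
    by (simp add: form_le_def q_def right_diff_distrib sum_subtractf sum_distrib_left
        power2_eq_square mult.left_commute)
  have q_le: "q F v \<le> \<kappa> * (\<Sum>i\<in>F. (v i)\<^sup>2)" if v: "test_function F v" for F v
  proof -
    have xy: "- (y * z) \<le> y\<^sup>2 + z\<^sup>2" for y z :: real
      using zero_le_power2[of "y + z"] zero_le_power2[of y] zero_le_power2[of z]
      unfolding power2_sum by linarith
    have "q F v = (\<Sum>i\<in>F. M * (v i)\<^sup>2 + - (v i * jacobi T a b v i))"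
      by (simp add: q_def algebra_simps power2_eq_square)
    also have "\<dots> \<le> (\<Sum>i\<in>F. \<bar>M\<bar> * (v i)\<^sup>2 + ((v i)\<^sup>2 + (jacobi T a b v i)\<^sup>2))"
      by (intro sum_mono add_mono xy mult_right_mono) auto
    also have "\<dots> \<le> \<kappa> * (\<Sum>i\<in>F. (v i)\<^sup>2)"
      using jacobi_norm_bound[of F F v] v
      by (simp add: sum.distrib test_function_def \<kappa>_def K2_def distrib_right flip: sum_distrib_left)
    finally show ?thesis .
  qed
  have main: "(\<Sum>i\<in>L. (jacobi T a b u i - M * u i)\<^sup>2)
      \<le> \<kappa> * (M * (\<Sum>i\<in>K. (u i)\<^sup>2) - (\<Sum>i\<in>K. u i * jacobi T a b u i))"
    if u: "test_function K u" and L: "finite L" "L \<subseteq> verts T" for K L u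
  proof -
    \<comment> \<open>Large enough to support \<open>w = P u\<close> as well, so that
      \<open>w\<close> and \<open>v\<close> are themselves test functions.\<close>
    define F where "F = nbhd K \<union> L"
    have K: "finite K" "K \<subseteq> verts T" "\<And>i. i \<notin> K \<Longrightarrow> u i = 0"
      using u by (auto simp: test_function_def)
    have F: "finite F" "F \<subseteq> verts T" "K \<subseteq> F" "L \<subseteq> F"
      using nbhd[OF K(1,2)] L by (auto simp: F_def) (auto simp: nbhd_def)
    define w where "w i = M * u i - jacobi T a b u i" for i
    have u0: "u i = 0" if "i \<notin> F" for i
      using that K F by auto
    have w0: "w i = 0" if "i \<notin> F" for i
    proof -
      have "jacobi T a b u i = 0"
        using that by (intro jacobi_support[OF K(2)] K(3)) (auto simp: F_def)
      then show ?thesis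
        using u0[OF that] by (simp add: w_def)
    qed
    define W where "W = (\<Sum>i\<in>F. (w i)\<^sup>2)"
    \<comment> \<open>The choice of \<open>s\<close> that minimizes
      \<open>- 2 s W + s^2 \<kappa> W\<close>, the bound for the change in \<open>q\<close> from
      \<open>u\<close> to \<open>u - s w\<close>.\<close>
    define s where "s = 1 / \<kappa>"
    define v where "v i = u i - s * w i" for i
    have test: "test_function F v" "test_function F w"
      using F u0 w0 by (auto simp: test_function_def v_def)
    \<comment> \<open>Symmetry moves \<open>P\<close> from \<open>w\<close> back to
      \<open>u\<close>, where it gives \<open>w\<close> again; hence both cross terms of
      \<open>q F v\<close> equal \<open>W\<close>.\<close>
    have sym: "(\<Sum>i\<in>F. u i * (M * w i - jacobi T a b w i)) = W"
    proof -
      have "(\<Sum>i\<in>F. u i * (M * w i - jacobi T a b w i))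
          = (\<Sum>i\<in>F. M * u i * w i) - (\<Sum>i\<in>F. u i * jacobi T a b w i)"
        by (simp add: right_diff_distrib sum_subtractf mult_ac)
      also have "(\<Sum>i\<in>F. u i * jacobi T a b w i) = (\<Sum>i\<in>F. w i * jacobi T a b u i)"
        by (rule jacobi_symmetric[OF F(1,2), symmetric]) (use u0 w0 in auto)
      also have "(\<Sum>i\<in>F. M * u i * w i) - \<dots> = (\<Sum>i\<in>F. w i * (M * u i - jacobi T a b u i))"
        by (simp add: right_diff_distrib sum_subtractf mult_ac)
      finally show ?thesis
        by (simp add: W_def power2_eq_square flip: w_def)
    qed
    have "q F v = (\<Sum>i\<in>F. u i * w i - s * (w i)\<^sup>2 - s * (u i * (M * w i - jacobi T a b w i))
        + s\<^sup>2 * (w i * (M * w i - jacobi T a b w i)))"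
      unfolding q_def v_def jacobi_diff_scale
      by (intro sum.cong) (auto simp: w_def[of i for i] power2_eq_square algebra_simps)
    also have "\<dots> = q F u - s * W - s * W + s\<^sup>2 * q F w"
      by (simp add: sum.distrib sum_subtractf W_def[symmetric] sym q_def w_def[symmetric]
          flip: sum_distrib_left)
    also have "\<dots> \<le> q F u - s * W - s * W + s\<^sup>2 * (\<kappa> * W)"
      using q_le[OF test(2)] by (simp add: W_def mult_left_mono)
    also have "\<dots> = q F u - s * W"
      using \<kappa> by (simp add: s_def power2_eq_square)
    finally have "s * W \<le> q F u"
      using q_nonneg[OF test(1)] by linarith
    then have "W \<le> \<kappa> * q F u"
      using \<kappa> by (simp add: s_def field_simps)
    moreover have "q F u = M * (\<Sum>i\<in>K. (u i)\<^sup>2) - (\<Sum>i\<in>K. u i * jacobi T a b u i)"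
    proof -
      have "q F u = q K u"
        unfolding q_def using F K by (intro sum.mono_neutral_right) auto
      then show ?thesis
        by (simp add: q_def right_diff_distrib sum_subtractf sum_distrib_left power2_eq_square
            mult.left_commute)
    qed
    moreover have "(\<Sum>i\<in>L. (jacobi T a b u i - M * u i)\<^sup>2) \<le> W"
      unfolding W_def w_def using F by (subst power2_commute) (intro sum_mono2, auto)
    ultimately show ?thesis
      by simp
  qed
  show thesis
    using that[OF \<kappa> main] .
qed

text \<open>Weyl's criterion: a test function that almost attains the supremum has a small residual
  by \<open>residual_le_form\<close>, which contradicts the lower bound that a resolvent point
  provides.\<close>

lemma form_sup_in_spectrum:
  assumes form: "form_le M" and approx: "form_approx M"
  shows "complex_of_real M \<in> spectrum (verts T) (jacobi T a b)"
proof (rule ccontr)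
  let ?V = "verts T"
  assume "complex_of_real M \<notin> spectrum ?V (jacobi T a b)"
  then obtain C where C: "\<And>u. u \<in> ell2 ?V \<Longrightarrow>
      ell2_norm ?V u \<le> C * ell2_norm ?V (\<lambda>i. jacobi T a b u i - complex_of_real M * u i)"
    by (auto simp: spectrum_def resolvent_set_def)
  obtain \<kappa> where \<kappa>: "\<kappa> > 0" and res: "\<And>K L u. test_function K u \<Longrightarrow> finite L \<Longrightarrow> L \<subseteq> verts T \<Longrightarrow>
    (\<Sum>i\<in>L. (jacobi T a b u i - M * u i)\<^sup>2)
      \<le> \<kappa> * (M * (\<Sum>i\<in>K. (u i)\<^sup>2) - (\<Sum>i\<in>K. u i * jacobi T a b u i))"
    using residual_le_form[OF form] by blast
  \<comment> \<open>Chosen so that \<open>C^2 \<kappa> \<epsilon> \<le> 1/2\<close>, which will give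
    \<open>N \<le> N / 2\<close>; adding 1 to \<open>C^2\<close> covers
    \<open>C = 0\<close>.\<close>
  define \<epsilon> where "\<epsilon> = 1 / (2 * \<kappa> * (C\<^sup>2 + 1))"
  have C1: "C\<^sup>2 + 1 > 0"
    by (simp add: add_nonneg_pos)
  have \<epsilon>: "\<epsilon> > 0"
    using \<kappa> C1 by (simp add: \<epsilon>_def)
  obtain K u where u: "test_function K u" and N: "(\<Sum>i\<in>K. (u i)\<^sup>2) > 0"
    and q: "(\<Sum>i\<in>K. u i * jacobi T a b u i) \<ge> (M - \<epsilon>) * (\<Sum>i\<in>K. (u i)\<^sup>2)"
    using approx \<epsilon> unfolding form_approx_def by blast
  define N where "N = (\<Sum>i\<in>K. (u i)\<^sup>2)"
  have K: "finite K" "K \<subseteq> ?V" and supp: "\<And>i. i \<notin> K \<Longrightarrow> u i = 0"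
    using u by (auto simp: test_function_def)
  define U where "U i = complex_of_real (u i)" for i
  have RU: "jacobi T a b U i - complex_of_real M * U i = of_real (jacobi T a b u i - M * u i)" for i
    by (simp add: U_def jacobi_def scaleR_conv_of_real)
  have U_in: "U \<in> ell2 ?V"
  proof (rule ell2I(1))
    fix F assume F: "finite F" "F \<subseteq> ?V"
    have "(\<Sum>i\<in>F. (u i)\<^sup>2) = (\<Sum>i\<in>F \<inter> K. (u i)\<^sup>2)"
      using F supp by (intro sum.mono_neutral_right) auto
    also have "\<dots> \<le> N"
      unfolding N_def using K by (intro sum_mono2) auto
    finally show "L2_set (\<lambda>i. cmod (U i)) F \<le> sqrt N"
      by (simp add: L2_set_def U_def)
  qed (use supp K in \<open>auto simp: U_def\<close>)
  have "L2_set (\<lambda>i. cmod (of_real (jacobi T a b u i - M * u i))) F \<le> sqrt (\<kappa> * (\<epsilon> * N))"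
    if F: "finite F" "F \<subseteq> ?V" for F
  proof -
    have "(\<Sum>i\<in>F. (jacobi T a b u i - M * u i)\<^sup>2) \<le> \<kappa> * (M * N - (\<Sum>i\<in>K. u i * jacobi T a b u i))"
      unfolding N_def by (rule res[OF u F])
    also have "\<dots> \<le> \<kappa> * (\<epsilon> * N)"
      using q \<kappa> by (intro mult_left_mono) (auto simp: N_def algebra_simps)
    finally show ?thesis
      by (simp add: L2_set_def del: of_real_diff of_real_mult)
  qed
  then have RU_le: "ell2_norm ?V (\<lambda>i. of_real (jacobi T a b u i - M * u i)) \<le> sqrt (\<kappa> * (\<epsilon> * N))"
    using supp K by (intro ell2I(2)) (auto simp: jacobi_def)
  have "sqrt N = L2_set (\<lambda>i. cmod (U i)) K"
    by (simp add: L2_set_def U_def N_def)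
  also have "\<dots> \<le> ell2_norm ?V U"
    by (rule L2_set_le_ell2_norm[OF U_in K])
  also have "\<dots> \<le> C * ell2_norm ?V (\<lambda>i. of_real (jacobi T a b u i - M * u i))"
    using C[OF U_in] by (simp only: RU)
  also have "\<dots> \<le> \<bar>C\<bar> * sqrt (\<kappa> * (\<epsilon> * N))"
    by (intro mult_mono RU_le) (auto simp: ell2_norm_nonneg)
  finally have "(sqrt N)\<^sup>2 \<le> (\<bar>C\<bar> * sqrt (\<kappa> * (\<epsilon> * N)))\<^sup>2"
    using N by (intro power_mono) (auto simp: N_def)
  then have "N \<le> C\<^sup>2 * (\<kappa> * (\<epsilon> * N))"
    using N \<kappa> \<epsilon> by (simp add: N_def power_mult_distrib)
  also have "\<dots> = C\<^sup>2 / (C\<^sup>2 + 1) * (N / 2)"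
    using \<kappa> C1 by (simp add: \<epsilon>_def)
  also have "\<dots> \<le> 1 * (N / 2)"
    using N C1 by (intro mult_right_mono) (auto simp: N_def)
  finally show False
    using N by (simp add: N_def)
qed

lemma Sup_spectrum:
  assumes form: "form_le M" and approx: "form_approx M"
  shows "Sup {x. complex_of_real x \<in> spectrum (verts T) (jacobi T a b)} = M"
proof (rule cSup_eq_maximum)
  show "M \<in> {x. complex_of_real x \<in> spectrum (verts T) (jacobi T a b)}"
    using form_sup_in_spectrum[OF assms] by simp
next
  fix x assume "x \<in> {x. complex_of_real x \<in> spectrum (verts T) (jacobi T a b)}"
  then show "x \<le> M"
    using coercive_resolvent[OF form, of x] by (force simp: spectrum_def)
qed

lemma form_approx_le:
  assumes "form_approx c" "form_le M"
  shows "c \<le> M"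
proof (rule field_le_epsilon)
  fix \<epsilon> :: real assume "\<epsilon> > 0"
  then obtain K u where "test_function K u" "(\<Sum>i\<in>K. (u i)\<^sup>2) > 0"
    "(c - \<epsilon>) * (\<Sum>i\<in>K. (u i)\<^sup>2) \<le> (\<Sum>i\<in>K. u i * jacobi T a b u i)"
    using assms(1) unfolding form_approx_def by blast
  moreover from this have "(\<Sum>i\<in>K. u i * jacobi T a b u i) \<le> M * (\<Sum>i\<in>K. (u i)\<^sup>2)"
    using assms(2) unfolding form_le_def by blast
  ultimately have "(c - \<epsilon>) * (\<Sum>i\<in>K. (u i)\<^sup>2) \<le> M * (\<Sum>i\<in>K. (u i)\<^sup>2)"
    by linarith
  then show "c \<le> M + \<epsilon>"
    using \<open>(\<Sum>i\<in>K. (u i)\<^sup>2) > 0\<close> by simp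
qed

text \<open>Both bounds compare \<open>c\<close> with the supremum of the Rayleigh quotients,
  identified above as the top of the spectrum. From here on only form inequalities have to be
  proved.\<close>

lemma Sup_spectrum_bounds:
  assumes "verts T \<noteq> {}"
  shows "form_le c \<Longrightarrow> Sup {x. complex_of_real x \<in> spectrum (verts T) (jacobi T a b)} \<le> c"
    and "form_approx c \<Longrightarrow> c \<le> Sup {x. complex_of_real x \<in> spectrum (verts T) (jacobi T a b)}"
  using ex_form_sup[OF assms] Sup_spectrum form_approx_le by metis+

end

section \<open>Levels of a rooted regular tree\<close>

lemma walk_append: "walk G i xs j \<Longrightarrow> walk G j ys k \<Longrightarrow> walk G i (xs @ ys) k"
  by (induction G i xs j rule: walk.induct) auto

locale regular_tree = regular_graph T d
  for T :: "('t, 'f) multigraph" and d :: nat +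
  fixes root :: 't
  assumes tree: "is_tree T" and root: "root \<in> verts T"
begin

text \<open>Distance to the root, measured along walks towards the root, so that the first dart of a
  shortest walk from \<open>v\<close> leads to a parent of \<open>v\<close>.\<close>

definition level :: "'t \<Rightarrow> nat" where
  "level v = (LEAST n. \<exists>xs. walk T v xs root \<and> length xs = n)"

lemma level_le: "walk T v xs root \<Longrightarrow> level v \<le> length xs"
  unfolding level_def by (rule Least_le) blast

lemma shortest_walk:
  assumes "v \<in> verts T"
  obtains xs where "walk T v xs root" "length xs = level v"
proof -
  have "\<exists>n xs. walk T v xs root \<and> length xs = n"
    using tree root assms by (auto simp: is_tree_def connected_multigraph_def)
  then have "\<exists>xs. walk T v xs root \<and> length xs = level v"
    unfolding level_def by (rule LeastI_ex)
  then show thesis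
    using that by blast
qed

lemma level_root: "level root = 0"
  using level_le[of root "[]"] root by simp

lemma level_0_iff: "v \<in> verts T \<Longrightarrow> level v = 0 \<longleftrightarrow> v = root"
  by (metis length_0_conv level_root shortest_walk walk.simps(1))

lemma level_source_le:
  assumes "x \<in> darts T"
  shows "level (source T x) \<le> Suc (level (target T x))"
proof -
  obtain xs where xs: "walk T (target T x) xs root" "length xs = level (target T x)"
    using shortest_walk target_in_verts[OF wf assms] by blast
  then have "walk T (source T x) (x # xs) root"
    using assms by (simp add: star_def)
  then show ?thesis
    using level_le xs(2) by fastforce
qed

lemma level_target_le:
  assumes "x \<in> darts T"
  shows "level (target T x) \<le> Suc (level (source T x))"
  using level_source_le[of "flip x"] assms by simp

lemma ex_parent:
  assumes "v \<in> verts T" "level v = Suc n"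
  shows "\<exists>x\<in>star T v. level (target T x) = n"
proof -
  obtain xs where xs: "walk T v xs root" "length xs = Suc n"
    using shortest_walk assms by metis
  then obtain x ys where x: "xs = x # ys" "x \<in> star T v" "walk T (target T x) ys root"
    by (cases xs) auto
  then have "level (target T x) \<le> n"
    using level_le xs(2) by fastforce
  moreover have "Suc n \<le> Suc (level (target T x))"
    using level_source_le[of x] x(2) assms(2) by (simp add: star_def)
  ultimately show ?thesis
    using x(2) by (intro bexI[of _ x]) auto
qed

text \<open>Descend from \<open>v\<close> and from \<open>w\<close> towards the root until the two branches meet.\<close>

lemma path_below_level:
  assumes "v \<in> verts T" "w \<in> verts T" "level v = n" "level w = n"
  shows "\<exists>xs. walk T v xs w \<and> distinct (map (source T) xs @ [w]) \<and> distinct (map fst xs) \<and>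
    (\<forall>z\<in>set xs. level (source T z) \<le> n \<and> level (target T z) \<le> n \<and>
       level (source T z) \<noteq> level (target T z))"
  using assms
proof (induction n arbitrary: v w)
  case 0
  then have "v = w"
    using level_0_iff by metis
  then show ?case
    using 0 by (intro exI[of _ "[]"]) auto
next
  case (Suc n)
  show ?case
  proof (cases "v = w")
    case True
    then show ?thesis
      using Suc by (intro exI[of _ "[]"]) auto
  next
    case False
    obtain x where x: "x \<in> star T v" "level (target T x) = n"
      using ex_parent Suc.prems by blast
    obtain y where y: "y \<in> star T w" "level (target T y) = n"
      using ex_parent Suc.prems by blast
    have x': "x \<in> darts T" "source T x = v" and y': "y \<in> darts T" "source T y = w"
      using x y by (auto simp: star_def)
    obtain xs where xs: "walk T (target T x) xs (target T y)"
      "distinct (map (source T) xs @ [target T y])" "distinct (map fst xs)"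
      "\<forall>z\<in>set xs. level (source T z) \<le> n \<and> level (target T z) \<le> n \<and>
         level (source T z) \<noteq> level (target T z)"
      using Suc.IH[of "target T x" "target T y"] x(2) y(2) x'(1) y'(1) target_in_verts[OF wf]
      by blast
    \<comment> \<open>The inner path stays below level \<open>Suc n\<close>, so adding
      \<open>x\<close> and \<open>y\<close>, which touch that level, repeats neither an edge nor a
      vertex.\<close>
    have low: "level (source T z) \<noteq> Suc n \<and> level (target T z) \<noteq> Suc n" if "z \<in> set xs" for z
      using xs(4) that by fastforce
    have new: "fst c \<notin> fst ` set xs" if c: "level (source T c) = Suc n" for c
    proof
      assume "fst c \<in> fst ` set xs"
      then obtain z where "z \<in> set xs" "fst z = fst c"
        by (metis imageE)
      then show False
        using same_edge_cases[of z c] low[of z] c by auto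
    qed
    let ?p = "x # xs @ [flip y]"
    have "walk T w [] w"
      using Suc.prems by simp
    then have "walk T (target T x) (xs @ [flip y]) w"
      using y' by (intro walk_append[OF xs(1)]) (simp add: star_def)
    then have "walk T v ?p w"
      using x by simp
    moreover have "u \<notin> source T ` set xs \<and> u \<noteq> target T y" if "level u = Suc n" for u
      using that low y(2) by (metis imageE n_not_Suc_n)
    from this[OF Suc.prems(3)] this[OF Suc.prems(4)] have "distinct (map (source T) ?p @ [w])"
      using xs(2) False x'(2) by auto
    moreover have "fst x \<noteq> fst y"
      using same_edge_cases[of x y] x(2) x'(2) y(2) y'(2) False Suc.prems(3,4)
      by (metis n_not_Suc_n source_flip)
    then have "distinct (map fst ?p)"
      using xs(3) new[of x] new[of y] x'(2) y'(2) Suc.prems by simp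
    moreover have "\<forall>z\<in>set ?p. level (source T z) \<le> Suc n \<and> level (target T z) \<le> Suc n \<and>
         level (source T z) \<noteq> level (target T z)"
      using xs(4) x(2) x'(2) y(2) y'(2) Suc.prems by (simp add: le_SucI)
    ultimately show ?thesis
      by (intro exI[of _ ?p] conjI)
  qed
qed

lemma no_cycle: "\<not> is_cycle T xs"
  using tree by (auto simp: is_tree_def)

text \<open>A horizontal edge would close the path below its ends to a cycle. It does not occur on
  that path, where every step changes the level. For a self-loop the path is empty.\<close>

lemma level_source_neq_target:
  assumes x: "x \<in> darts T"
  shows "level (source T x) \<noteq> level (target T x)"
proof
  assume eq: "level (source T x) = level (target T x)"
  obtain xs where xs: "walk T (target T x) xs (source T x)"
    "distinct (map (source T) xs @ [source T x])" "distinct (map fst xs)"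
    "\<forall>z\<in>set xs. level (source T z) \<noteq> level (target T z)"
    using path_below_level[of "target T x" "source T x", OF _ _ refl eq]
      source_in_verts[OF wf x] target_in_verts[OF wf x] by blast
  have "fst z \<noteq> fst x" if "z \<in> set xs" for z
    using same_edge_cases[of z x] xs(4) that eq by fastforce
  then have "fst x \<notin> fst ` set xs"
    by (metis imageE)
  then have "is_cycle T (x # xs)"
    using xs x by (auto simp: is_cycle_def star_def)
  then show False
    using no_cycle by blast
qed

text \<open>Two distinct darts down from \<open>v\<close>, joined by a path at levels at most
  \<open>n\<close>, would form a cycle. Uniqueness is claimed for darts, which also excludes
  parallel edges to one parent.\<close>

lemma parent_unique:
  assumes x: "x \<in> star T v" "level (target T x) = n"
    and y: "y \<in> star T v" "level (target T y) = n"
    and v: "level v = Suc n"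
  shows "x = y"
proof (rule ccontr)
  assume "x \<noteq> y"
  have x': "x \<in> darts T" "source T x = v" and y': "y \<in> darts T" "source T y = v"
    using x y by (auto simp: star_def)
  obtain xs where xs: "walk T (target T x) xs (target T y)"
    "distinct (map (source T) xs @ [target T y])" "distinct (map fst xs)"
    "\<forall>z\<in>set xs. level (source T z) \<le> n \<and> level (target T z) \<le> n"
    using path_below_level[of "target T x" "target T y", OF _ _ x(2) y(2)]
      target_in_verts[OF wf x'(1)] target_in_verts[OF wf y'(1)] by blast
  have low: "level (source T z) \<noteq> Suc n \<and> level (target T z) \<noteq> Suc n" if "z \<in> set xs" for z
    using xs(4) that by fastforce
  have new: "fst c \<notin> fst ` set xs" if c: "source T c = v" for c
  proof
    assume "fst c \<in> fst ` set xs"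
    then obtain z where "z \<in> set xs" "fst z = fst c"
      by (metis imageE)
    then show False
      using same_edge_cases[of z c] low[of z] c v by auto
  qed
  let ?p = "x # xs @ [flip y]"
  have "walk T (target T x) (xs @ [flip y]) v"
    using y' source_in_verts[OF wf y'(1)] by (intro walk_append[OF xs(1)]) (simp add: star_def)
  then have "walk T v ?p v"
    using x by simp
  moreover have "distinct (map (source T) ?p)"
    using xs(2) low v x x' y by auto
  moreover have "fst x \<noteq> fst y"
    using same_edge_cases[of x y] x x' y y' v \<open>x \<noteq> y\<close> by auto
  then have "distinct (map fst ?p)"
    using xs(3) new[of x] new[of y] x'(2) y'(2) by simp
  ultimately have "is_cycle T ?p"
    by (auto simp: is_cycle_def)
  then show False
    using no_cycle by blast
qed

lemma level_target_cases:
  assumes "x \<in> star T v"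
  shows "level (target T x) = Suc (level v) \<or> level v = Suc (level (target T x))"
  using assms level_source_le[of x] level_target_le[of x] level_source_neq_target[of x]
  by (auto simp: star_def)

text \<open>Kept as darts, not vertices, so that a sum over the star splits into the parent dart and
  this set.\<close>

definition children :: "'t \<Rightarrow> ('f \<times> bool) set" where
  "children v = {x \<in> star T v. level (target T x) = Suc (level v)}"

lemma star_root: "star T root = children root"
  using level_target_cases[of _ root] by (auto simp: children_def level_root)

lemma star_nonroot:
  assumes "v \<in> verts T" "v \<noteq> root"
  obtains x where "x \<in> star T v" "level v = Suc (level (target T x))" "x \<notin> children v"
    "star T v = insert x (children v)"
proof -
  obtain n where n: "level v = Suc n"
    using assms level_0_iff[of v] by (cases "level v") auto
  obtain x where x: "x \<in> star T v" "level (target T x) = n"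
    using ex_parent assms n by blast
  have "y = x \<or> y \<in> children v" if "y \<in> star T v" for y
    using parent_unique[OF _ _ x n, of y] level_target_cases[OF that] that n
    by (auto simp: children_def)
  then show thesis
    using x n by (intro that[of x]) (auto simp: children_def)
qed

lemma finite_children: "v \<in> verts T \<Longrightarrow> finite (children v)"
  using finite_star by (simp add: children_def)

lemma card_children:
  assumes "v \<in> verts T" "v \<noteq> root"
  shows "d = Suc (card (children v))"
  by (metis assms card_insert_disjoint card_star finite_children star_nonroot)

section \<open>Growth of the levels\<close>

definition level_set :: "nat \<Rightarrow> 't set" where
  "level_set n = {v \<in> verts T. level v = n}"

lemma level_set_0: "level_set 0 = {root}"
  using root level_0_iff by (auto simp: level_set_def)

lemma level_set_Suc_subset: "level_set (Suc n) \<subseteq> target T ` darts_from (level_set n)"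
proof
  fix v assume v: "v \<in> level_set (Suc n)"
  then obtain x where x: "x \<in> star T v" "level (target T x) = n"
    using ex_parent[of v n] unfolding level_set_def by blast
  then have "flip x \<in> darts_from (level_set n)" "target T (flip x) = v"
    using target_in_verts[OF wf, of x] by (auto simp: darts_from_def level_set_def star_def)
  then show "v \<in> target T ` darts_from (level_set n)"
    by (metis imageI)
qed

lemma finite_level_set: "finite (level_set n)"
proof (induction n)
  case 0
  show ?case by (simp add: level_set_0)
next
  case (Suc n)
  then have "finite (darts_from (level_set n))"
    by (intro finite_darts_from) (auto simp: level_set_def)
  then show ?case
    using level_set_Suc_subset finite_subset by blast
qed

lemma card_level_set_Suc_sum: "card (level_set (Suc n)) = (\<Sum>v\<in>level_set n. card (children v))"
proof -
  have "bij_betw (target T) (\<Union>v\<in>level_set n. children v) (level_set (Suc n))"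
    unfolding bij_betw_def
  proof
    show "inj_on (target T) (\<Union>v\<in>level_set n. children v)"
    proof (rule inj_onI)
      fix x y assume *: "x \<in> (\<Union>v\<in>level_set n. children v)" "y \<in> (\<Union>v\<in>level_set n. children v)"
        "target T x = target T y"
      \<comment> \<open>Reversed, both darts lead from the common child to a parent, and the parent
        dart is unique.\<close>
      then have "flip x = flip y"
        by (intro parent_unique[of _ "target T x" n]) (auto simp: children_def level_set_def star_def)
      then show "x = y"
        by (metis flip_flip)
    qed
    show "target T ` (\<Union>v\<in>level_set n. children v) = level_set (Suc n)"
    proof
      show "target T ` (\<Union>v\<in>level_set n. children v) \<subseteq> level_set (Suc n)"
        using target_in_verts[OF wf] by (auto simp: children_def level_set_def star_def)
      show "level_set (Suc n) \<subseteq> target T ` (\<Union>v\<in>level_set n. children v)"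
      proof
        fix w assume w: "w \<in> level_set (Suc n)"
        then obtain x where x: "x \<in> darts_from (level_set n)" "w = target T x"
          using level_set_Suc_subset by blast
        then have "x \<in> children (source T x)" "source T x \<in> level_set n"
          using w by (auto simp: darts_from_def children_def level_set_def star_def)
        then show "w \<in> target T ` (\<Union>v\<in>level_set n. children v)"
          using x(2) by blast
      qed
    qed
  qed
  then have "card (level_set (Suc n)) = card (\<Union>v\<in>level_set n. children v)"
    by (simp add: bij_betw_same_card)
  also have "\<dots> = (\<Sum>v\<in>level_set n. card (children v))"
    using finite_level_set finite_children
    by (intro card_UN_disjoint) (auto simp: level_set_def children_def star_def)
  finally show ?thesis .
qed

lemma card_level_set_Suc:
  assumes n: "n > 0"
  shows "card (level_set (Suc n)) = (d - 1) * card (level_set n)"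
proof -
  have "(\<Sum>v\<in>level_set n. card (children v)) = (\<Sum>v\<in>level_set n. d - 1)"
  proof (rule sum.cong)
    fix v assume "v \<in> level_set n"
    then have "v \<in> verts T" "v \<noteq> root"
      using n by (auto simp: level_set_def level_root)
    then show "card (children v) = d - 1"
      using card_children by fastforce
  qed simp
  then show ?thesis
    by (simp add: card_level_set_Suc_sum)
qed

lemma card_level_set_1: "card (level_set (Suc 0)) = d"
  using card_star[OF root] by (simp add: card_level_set_Suc_sum level_set_0 star_root)

end

section \<open>Ground state substitution and the free energy\<close>

context regular_graph
begin

lemma sum_darts_from_mono_neutral:
  fixes h :: "'f \<times> bool \<Rightarrow> real"
  assumes "finite K" "K \<subseteq> verts T" and "\<And>x. source T x \<notin> K \<Longrightarrow> h x = 0"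
  shows "(\<Sum>x\<in>darts_from (nbhd K). h x) = (\<Sum>x\<in>darts_from K. h x)"
  using assms nbhd[OF assms(1,2)]
  by (intro sum.mono_neutral_right finite_darts_from) (auto simp: darts_from_def nbhd_def)

text \<open>A reversed dart ends in \<open>K\<close> and hence starts in \<open>nbhd K\<close>. This
  is why edge sums are taken over \<open>darts_from (nbhd K)\<close>, where boundary edges too
  appear in both orientations.\<close>

lemma sum_nbhd_flip:
  fixes h :: "'f \<times> bool \<Rightarrow> real"
  assumes K: "finite K" "K \<subseteq> verts T" and h: "\<And>x. source T x \<notin> K \<Longrightarrow> h x = 0"
  shows "(\<Sum>x\<in>darts_from (nbhd K). h (flip x)) = (\<Sum>x\<in>darts_from K. h x)"
proof -
  have "(\<Sum>x\<in>darts_from (nbhd K). h x) = (\<Sum>x\<in>darts_from (nbhd K). h (flip x))"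
    using h by (intro sum_darts_flip nbhd[OF K]) (force simp: nbhd_def darts_from_def)+
  then show ?thesis
    using sum_darts_from_mono_neutral[OF K, of h] h by simp
qed

text \<open>Testing the equation for \<phi> against \<open>\<phi> f^2\<close> yields the same
  diagonal terms in \<open>b\<close> as the form at \<open>\<phi> f\<close>, so they cancel. What
  remains is the sum of \<open>c x (f_s^2 - f_s f_t)\<close>, with \<open>s\<close> and
  \<open>t\<close> the source and target of \<open>x\<close>; symmetrizing it under reversal gives
  half the sum of the squares.\<close>

lemma ground_state_form:
  fixes f \<phi> :: "'t \<Rightarrow> real"
  assumes f: "test_function K f"
    and \<phi>: "\<And>j. j \<in> verts T \<Longrightarrow> jacobi T a b \<phi> j = \<sigma> * \<phi> j"
  shows "\<sigma> * (\<Sum>i\<in>K. (\<phi> i * f i)\<^sup>2) - (\<Sum>i\<in>K. \<phi> i * f i * jacobi T a b (\<lambda>i. \<phi> i * f i) i)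
    = (\<Sum>x\<in>darts_from (nbhd K). a (fst x) * \<phi> (source T x) * \<phi> (target T x)
        * (f (source T x) - f (target T x))\<^sup>2) / 2"
proof -
  have K: "finite K" "K \<subseteq> verts T" and supp: "\<And>i. i \<notin> K \<Longrightarrow> f i = 0"
    using f by (auto simp: test_function_def)
  define c where "c x = a (fst x) * \<phi> (source T x) * \<phi> (target T x)" for x
  let ?s = "\<lambda>x. f (source T x)" and ?t = "\<lambda>x. f (target T x)"
  have "\<sigma> * (\<Sum>i\<in>K. (\<phi> i * f i)\<^sup>2) = (\<Sum>i\<in>K. (\<phi> i * (f i)\<^sup>2) * jacobi T a b \<phi> i)"
    unfolding sum_distrib_left using K \<phi>
    by (intro sum.cong) (auto simp: power2_eq_square)
  also have "\<dots> = (\<Sum>i\<in>K. b i * (\<phi> i * f i) * (\<phi> i * f i)) + (\<Sum>x\<in>darts_from K. c x * (?s x)\<^sup>2)"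
    unfolding sum_mult_jacobi[OF K] by (simp add: c_def power2_eq_square mult_ac)
  finally have 1: "\<sigma> * (\<Sum>i\<in>K. (\<phi> i * f i)\<^sup>2) = \<dots>" .
  have 2: "(\<Sum>i\<in>K. \<phi> i * f i * jacobi T a b (\<lambda>i. \<phi> i * f i) i)
      = (\<Sum>i\<in>K. b i * (\<phi> i * f i) * (\<phi> i * f i)) + (\<Sum>x\<in>darts_from K. c x * (?s x * ?t x))"
    unfolding sum_mult_jacobi[OF K] by (simp add: c_def mult_ac)
  have c_flip: "c (flip x) = c x" for x
    by (simp add: c_def)
  have "(\<Sum>x\<in>darts_from (nbhd K). c x * (?s x - ?t x)\<^sup>2)
      = (\<Sum>x\<in>darts_from (nbhd K). c x * (?s x)\<^sup>2) + (\<Sum>x\<in>darts_from (nbhd K). c x * (?t x)\<^sup>2)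
        - 2 * (\<Sum>x\<in>darts_from (nbhd K). c x * (?s x * ?t x))"
    unfolding sum_distrib_left sum.distrib[symmetric] sum_subtractf[symmetric]
    by (intro sum.cong) (auto simp: power2_eq_square algebra_simps)
  also have "(\<Sum>x\<in>darts_from (nbhd K). c x * (?s x)\<^sup>2) = (\<Sum>x\<in>darts_from K. c x * (?s x)\<^sup>2)"
    using supp by (intro sum_darts_from_mono_neutral K) auto
  also have "(\<Sum>x\<in>darts_from (nbhd K). c x * (?t x)\<^sup>2) = (\<Sum>x\<in>darts_from K. c x * (?s x)\<^sup>2)"
    using sum_nbhd_flip[OF K, of "\<lambda>x. c x * (?s x)\<^sup>2"] supp by (simp add: c_flip)
  also have "(\<Sum>x\<in>darts_from (nbhd K). c x * (?s x * ?t x)) = (\<Sum>x\<in>darts_from K. c x * (?s x * ?t x))"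
    using supp by (intro sum_darts_from_mono_neutral K) auto
  finally show ?thesis
    unfolding 1 2 by (simp add: c_def)
qed

definition energy :: "'t set \<Rightarrow> ('t \<Rightarrow> real) \<Rightarrow> real" where
  "energy K f = (\<Sum>x\<in>darts_from (nbhd K). (f (source T x) - f (target T x))\<^sup>2) / 2"

lemma energy_eq:
  assumes f: "test_function K f"
  shows "energy K f = real d * (\<Sum>i\<in>K. (f i)\<^sup>2) - (\<Sum>x\<in>darts_from K. f (source T x) * f (target T x))"
proof -
  have K: "finite K" "K \<subseteq> verts T"
    using f by (auto simp: test_function_def)
  \<comment> \<open>The free case of the ground state identity: constants are eigenfunctions of the
    adjacency operator with eigenvalue \<open>d\<close>.\<close>
  have "jacobi T (\<lambda>_. 1) (\<lambda>_. 0) (\<lambda>_. 1) j = real d * 1" if "j \<in> verts T" for j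
    using that card_star by (simp add: jacobi_def)
  from ground_state_form[OF f this] show ?thesis
    by (simp add: energy_def sum_mult_jacobi[OF K])
qed

end

section \<open>The bottom of the free energy on the regular tree\<close>

locale branching_tree = regular_tree T d root
  for T :: "('t, 'f) multigraph" and d :: nat and root :: 't +
  assumes d_ge_2: "d \<ge> 2"
begin

definition decay :: "'t \<Rightarrow> real" where
  "decay v = (1 / sqrt (real d - 1)) ^ level v"

lemma sqrt_pos: "sqrt (real d - 1) > 0"
  using d_ge_2 by simp

lemma sqrt_sq: "sqrt (real d - 1) * sqrt (real d - 1) = real d - 1"
  using d_ge_2 by simp

lemma decay_pos: "decay v > 0"
  using sqrt_pos by (simp add: decay_def)

lemma decay_sq: "(decay v)\<^sup>2 = (1 / (real d - 1)) ^ level v"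
proof -
  have "(decay v)\<^sup>2 = ((1 / sqrt (real d - 1))\<^sup>2) ^ level v"
    by (simp add: decay_def flip: power_mult) (simp add: mult.commute)
  then show ?thesis
    using d_ge_2 by (simp add: power_divide)
qed

lemma sum_children_decay:
  "(\<Sum>x\<in>children v. decay (target T x)) = real (card (children v)) * (decay v / sqrt (real d - 1))"
proof -
  have "(\<Sum>x\<in>children v. decay (target T x)) = (\<Sum>x\<in>children v. decay v / sqrt (real d - 1))"
    by (intro sum.cong) (auto simp: decay_def children_def)
  then show ?thesis by simp
qed

text \<open>The parent contributes \<open>sqrt (d - 1)\<close> times the value at \<open>v\<close>,
  and so do the \<open>d - 1\<close> children together.\<close>

lemma sum_star_decay:
  assumes v: "v \<in> verts T" "v \<noteq> root"
  shows "(\<Sum>x\<in>star T v. decay (target T x)) = 2 * sqrt (real d - 1) * decay v"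
proof -
  obtain x where x: "level v = Suc (level (target T x))" "x \<notin> children v"
    "star T v = insert x (children v)"
    using star_nonroot[OF v] by metis
  have "decay (target T x) = sqrt (real d - 1) * decay v"
    using sqrt_pos by (simp add: decay_def x(1))
  moreover have "real (card (children v)) * (decay v / sqrt (real d - 1)) = sqrt (real d - 1) * decay v"
    using card_children[OF v] sqrt_sq sqrt_pos by (simp add: field_simps)
  ultimately show ?thesis
    unfolding x(3) using finite_children[OF v(1)] x(2) by (simp add: sum_children_decay)
qed

text \<open>At the root there are \<open>d\<close> children and no parent, and
  \<open>d / sqrt (d - 1) \<le> 2 sqrt (d - 1)\<close> amounts to \<open>d \<ge> 2\<close>.\<close>

lemma sum_star_decay_le:
  assumes v: "v \<in> verts T"
  shows "(\<Sum>x\<in>star T v. decay (target T x)) \<le> 2 * sqrt (real d - 1) * decay v"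
proof (cases "v = root")
  case True
  have "real d \<le> 2 * (sqrt (real d - 1) * sqrt (real d - 1))"
    using d_ge_2 unfolding sqrt_sq by simp
  then have "real d / sqrt (real d - 1) \<le> 2 * sqrt (real d - 1)"
    using sqrt_pos by (simp only: divide_le_eq mult.assoc if_True)
  then have "real d / sqrt (real d - 1) * decay v \<le> 2 * sqrt (real d - 1) * decay v"
    using decay_pos[of v] by (intro mult_right_mono) auto
  moreover have "card (children root) = d"
    using card_star[OF root] by (simp add: star_root)
  ultimately show ?thesis
    by (simp add: True star_root sum_children_decay)
next
  case False
  then show ?thesis
    using sum_star_decay[OF v] by simp
qed

text \<open>The positive supersolution \<open>decay\<close> of \<open>Adj u = 2 sqrt (d - 1) u\<close> enters through
  \<open>2 f\<^sub>i f\<^sub>j \<le> f\<^sub>i\<^sup>2 g\<^sub>j / g\<^sub>i + f\<^sub>j\<^sup>2 g\<^sub>i / g\<^sub>j\<close> (Schur test).\<close>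

lemma adjacency_form_le:
  assumes f: "test_function K f"
  shows "(\<Sum>x\<in>darts_from K. f (source T x) * f (target T x))
    \<le> 2 * sqrt (real d - 1) * (\<Sum>i\<in>K. (f i)\<^sup>2)"
proof -
  have K: "finite K" "K \<subseteq> verts T" and supp: "\<And>i. i \<notin> K \<Longrightarrow> f i = 0"
    using f by (auto simp: test_function_def)
  define h where "h x = (f (source T x))\<^sup>2 * (decay (target T x) / decay (source T x))" for x
  have le: "f (source T x) * f (target T x) \<le> (h x + h (flip x)) / 2" for x
  proof -
    define p where "p = decay (target T x) / decay (source T x)"
    have p: "p > 0" using decay_pos by (simp add: p_def)
    have "0 \<le> (f (source T x) * sqrt p - f (target T x) / sqrt p)\<^sup>2"
      by simp
    also have "\<dots> = (f (source T x))\<^sup>2 * p + (f (target T x))\<^sup>2 / p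
        - 2 * (f (source T x) * f (target T x))"
      using p by (simp add: power2_diff power_mult_distrib power_divide)
    also have "\<dots> = h x + h (flip x) - 2 * (f (source T x) * f (target T x))"
      by (simp add: h_def p_def)
    finally show ?thesis by simp
  qed
  have h0: "h x = 0" if "source T x \<notin> K" for x
    using that supp by (simp add: h_def)
  have "(\<Sum>x\<in>darts_from K. f (source T x) * f (target T x))
      = (\<Sum>x\<in>darts_from (nbhd K). f (source T x) * f (target T x))"
    using sum_darts_from_mono_neutral[OF K, of "\<lambda>x. f (source T x) * f (target T x)"] supp by simp
  also have "\<dots> \<le> (\<Sum>x\<in>darts_from (nbhd K). (h x + h (flip x)) / 2)"
    by (intro sum_mono le)
  also have "\<dots> = ((\<Sum>x\<in>darts_from (nbhd K). h x) + (\<Sum>x\<in>darts_from (nbhd K). h (flip x))) / 2"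
    by (simp add: sum.distrib flip: sum_divide_distrib)
  \<comment> \<open>Reversal makes the two sums equal. Grouped at \<open>v\<close>, the terms are
    \<open>(f v)^2 / decay v\<close> times the sum of \<open>decay\<close> over the neighbours,
    where the supersolution property applies.\<close>
  also have "\<dots> = (\<Sum>x\<in>darts_from K. h x)"
    using sum_darts_from_mono_neutral[OF K, of h] sum_nbhd_flip[OF K, of h] h0 by simp
  also have "\<dots> = (\<Sum>v\<in>K. \<Sum>x\<in>star T v. h x)"
    by (rule sum_darts_from[OF K, symmetric])
  also have "\<dots> \<le> (\<Sum>v\<in>K. 2 * sqrt (real d - 1) * (f v)\<^sup>2)"
  proof (rule sum_mono)
    fix v assume "v \<in> K"
    then have v: "v \<in> verts T" using K by auto
    have "(\<Sum>x\<in>star T v. h x) = (f v)\<^sup>2 / decay v * (\<Sum>x\<in>star T v. decay (target T x))"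
      unfolding sum_distrib_left by (intro sum.cong) (auto simp: h_def star_def)
    also have "\<dots> \<le> (f v)\<^sup>2 / decay v * (2 * sqrt (real d - 1) * decay v)"
      using decay_pos[of v] by (intro mult_left_mono sum_star_decay_le v) auto
    finally show "(\<Sum>x\<in>star T v. h x) \<le> 2 * sqrt (real d - 1) * (f v)\<^sup>2"
      using decay_pos[of v] by (simp add: mult.commute)
  qed
  finally show ?thesis
    by (simp add: sum_distrib_left)
qed

lemma energy_ge:
  assumes "test_function K f"
  shows "(real d - 2 * sqrt (real d - 1)) * (\<Sum>i\<in>K. (f i)\<^sup>2) \<le> energy K f"
  using adjacency_form_le[OF assms] by (simp add: energy_eq[OF assms] algebra_simps)

lemma sum_radial:
  fixes F :: "nat \<Rightarrow> real"
  shows "(\<Sum>v\<in>(\<Union>l\<le>n. level_set l). F (level v)) = (\<Sum>l\<le>n. real (card (level_set l)) * F l)"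
proof -
  have "(\<Sum>v\<in>(\<Union>l\<le>n. level_set l). F (level v)) = (\<Sum>l\<le>n. \<Sum>v\<in>level_set l. F (level v))"
    using finite_level_set by (intro sum.UNION_disjoint) (auto simp: level_set_def)
  also have "\<dots> = (\<Sum>l\<le>n. \<Sum>v\<in>level_set l. F l)"
    by (intro sum.cong) (auto simp: level_set_def)
  finally show ?thesis by simp
qed

lemma card_level_set_decay:
  "real (card (level_set (Suc l))) * (1 / (real d - 1)) ^ Suc l = real d / (real d - 1)"
proof (induction l)
  case 0
  show ?case by (simp add: card_level_set_1)
next
  case (Suc l)
  have "real (card (level_set (Suc (Suc l)))) = (real d - 1) * real (card (level_set (Suc l)))"
    using d_ge_2 by (simp add: card_level_set_Suc of_nat_diff)
  then have "real (card (level_set (Suc (Suc l)))) * (1 / (real d - 1)) ^ Suc (Suc l)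
      = real (card (level_set (Suc l))) * (1 / (real d - 1)) ^ Suc l"
    using d_ge_2 by simp
  then show ?case
    using Suc by simp
qed

text \<open>Truncating \<open>decay\<close> at level \<open>n\<close>: every level carries the same mass, and only the root
  and the last level fail to satisfy the eigenvalue equation.\<close>

lemma energy_approx:
  assumes "\<epsilon> > 0"
  obtains K f where "test_function K f" "(\<Sum>i\<in>K. (f i)\<^sup>2) > 0"
    "energy K f \<le> (real d - 2 * sqrt (real d - 1) + \<epsilon>) * (\<Sum>i\<in>K. (f i)\<^sup>2)"
proof -
  define k where "k = sqrt (real d - 1)"
  define c where "c = real d / (real d - 1)"
  have c: "c > 0" and k: "k > 0"
    using d_ge_2 sqrt_pos by (auto simp: c_def k_def)
  \<comment> \<open>The defect of the truncation will be \<open>2 k (1 + c)\<close>, independent of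
    \<open>n\<close>, while its mass exceeds \<open>n c\<close>.\<close>
  obtain n where n: "2 * k * (1 + c) / (\<epsilon> * c) < real n"
    using reals_Archimedean2 by blast
  moreover have "0 \<le> 2 * k * (1 + c) / (\<epsilon> * c)"
    using c k assms by simp
  ultimately have n0: "n > 0"
    by linarith
  define K where "K = (\<Union>l\<le>n. level_set l)"
  define f where "f v = (if v \<in> K then decay v else 0)" for v
  have K_iff: "v \<in> K \<longleftrightarrow> v \<in> verts T \<and> level v \<le> n" for v
    by (auto simp: K_def level_set_def)
  have K: "finite K" "K \<subseteq> verts T"
    using K_iff by (auto simp: K_def finite_level_set)
  have f: "test_function K f"
    using K by (simp add: test_function_def f_def)
  have f_nonneg: "f v \<ge> 0" for v
    using decay_pos[of v] by (simp add: f_def)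
  have mass: "real (card (level_set l)) * (1 / (real d - 1)) ^ l = c" if "l > 0" for l
    using card_level_set_decay[of "l - 1"] that by (simp add: c_def)
  have "(\<Sum>i\<in>K. (f i)\<^sup>2) = (\<Sum>v\<in>K. (1 / (real d - 1)) ^ level v)"
    by (intro sum.cong) (auto simp: f_def decay_sq)
  also have "\<dots> = (\<Sum>l\<le>n. real (card (level_set l)) * (1 / (real d - 1)) ^ l)"
    unfolding K_def by (rule sum_radial)
  also have "\<dots> = 1 + (\<Sum>l=1..n. c)"
    unfolding atMost_atLeast0 sum.atLeast_Suc_atMost[OF le0]
    using mass by (simp add: level_set_0)
  finally have N: "(\<Sum>i\<in>K. (f i)\<^sup>2) = 1 + n * c"
    by simp
  \<comment> \<open>A radial lower bound for the adjacency form at each vertex: exact at interior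
    levels, and zero at the root and at level \<open>n\<close>, where nonnegativity
    suffices.\<close>
  define F where "F l = (if 1 \<le> l \<and> l < n then 2 * k * (1 / (real d - 1)) ^ l else 0)" for l
  have "(\<Sum>l\<le>n. real (card (level_set l)) * F l) = (\<Sum>l\<in>{1..<n}. real (card (level_set l)) * F l)"
    by (intro sum.mono_neutral_right) (auto simp: F_def)
  also have "\<dots> = (\<Sum>l\<in>{1..<n}. 2 * k * c)"
    using mass by (intro sum.cong) (auto simp: F_def)
  also have "\<dots> = 2 * k * (real n - 1) * c"
    using n0 by (simp add: of_nat_diff)
  finally have "2 * k * (real n - 1) * c = (\<Sum>v\<in>K. F (level v))"
    unfolding K_def sum_radial by simp
  also have "\<dots> \<le> (\<Sum>v\<in>K. f v * (\<Sum>x\<in>star T v. f (target T x)))"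
  proof (rule sum_mono)
    fix v assume v: "v \<in> K"
    show "F (level v) \<le> f v * (\<Sum>x\<in>star T v. f (target T x))"
    proof (cases "1 \<le> level v \<and> level v < n")
      case True
      then have "v \<noteq> root"
        by (auto simp: level_root)
      \<comment> \<open>Below level \<open>n\<close> all neighbours lie in \<open>K\<close>, so the
        truncation is not felt.\<close>
      have "f (target T x) = decay (target T x)" if "x \<in> star T v" for x
        using that True level_target_le[of x] target_in_verts[OF wf, of x]
        by (auto simp: f_def K_iff star_def)
      then have "f v * (\<Sum>x\<in>star T v. f (target T x)) = decay v * (2 * k * decay v)"
        using v \<open>v \<noteq> root\<close> sum_star_decay[of v] by (simp add: f_def K_iff k_def)
      also have "\<dots> = F (level v)"
        using True decay_sq[of v] by (simp add: F_def power2_eq_square)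
      finally show ?thesis by simp
    next
      case False
      then have "F (level v) = 0" by (auto simp: F_def)
      then show ?thesis
        using f_nonneg by (simp add: sum_nonneg)
    qed
  qed
  also have "\<dots> = (\<Sum>v\<in>K. \<Sum>x\<in>star T v. f (source T x) * f (target T x))"
    by (auto intro!: sum.cong simp: sum_distrib_left star_def)
  also have "\<dots> = (\<Sum>x\<in>darts_from K. f (source T x) * f (target T x))"
    by (rule sum_darts_from[OF K])
  finally have "energy K f \<le> real d * (1 + n * c) - 2 * k * (real n - 1) * c"
    unfolding energy_eq[OF f] N by simp
  also have "\<dots> = (real d - 2 * k) * (1 + n * c) + 2 * k * (1 + c)"
    by (simp add: algebra_simps)
  also have "2 * k * (1 + c) \<le> \<epsilon> * (1 + n * c)"
  proof -
    have "2 * k * (1 + c) \<le> \<epsilon> * (n * c)"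
      using n c assms by (simp add: divide_less_eq mult_ac)
    then show ?thesis
      using assms by (simp add: distrib_left)
  qed
  finally have "energy K f \<le> (real d - 2 * k + \<epsilon>) * (1 + n * c)"
    by (simp add: algebra_simps)
  moreover have "1 + n * c > 0"
    using c by (simp add: add_pos_nonneg)
  ultimately show thesis
    using f N by (intro that[of K f]) (auto simp: k_def)
qed

end

section \<open>From the free energy to the weighted form\<close>

context bounded_jacobi
begin

text \<open>With \<open>f = u / \<phi>\<close> the losses multiply: \<open>m\<close> in passing from
  the mass of \<open>u\<close> to that of \<open>f\<close>, \<open>l\<close> from mass to energy,
  and \<open>c\<close> from the free to the weighted energy.\<close>

lemma form_le_ground_state:
  assumes \<phi>_pos: "\<And>j. j \<in> verts T \<Longrightarrow> \<phi> j > 0"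
    and \<phi>: "\<And>j. j \<in> verts T \<Longrightarrow> jacobi T a b \<phi> j = \<sigma> * \<phi> j"
    and c: "0 \<le> c" "\<And>x. x \<in> darts T \<Longrightarrow> c \<le> a (fst x) * \<phi> (source T x) * \<phi> (target T x)"
    and m: "\<And>j. j \<in> verts T \<Longrightarrow> m \<le> 1 / (\<phi> j)\<^sup>2"
    and l: "0 \<le> l" "\<And>K f. test_function K f \<Longrightarrow> l * (\<Sum>i\<in>K. (f i)\<^sup>2) \<le> energy K f"
  shows "form_le (\<sigma> - m * c * l)"
  unfolding form_le_def
proof (intro allI impI)
  fix K u assume u: "test_function K u"
  then have K: "finite K" "K \<subseteq> verts T" and supp: "\<And>i. i \<notin> K \<Longrightarrow> u i = 0"
    by (auto simp: test_function_def)
  define f where "f i = u i / \<phi> i" for i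
  have f: "test_function K f"
    using u by (simp add: test_function_def f_def)
  have u_eq: "(\<lambda>i. \<phi> i * f i) = u"
  proof
    fix i
    show "\<phi> i * f i = u i"
      using supp[of i] \<phi>_pos[of i] K by (cases "i \<in> K") (auto simp: f_def)
  qed
  have "m * c * l * (\<Sum>i\<in>K. (u i)\<^sup>2) = c * (l * (\<Sum>i\<in>K. m * (u i)\<^sup>2))"
    by (simp add: sum_distrib_left mult_ac)
  also have "\<dots> \<le> c * (l * (\<Sum>i\<in>K. (f i)\<^sup>2))"
  proof (intro mult_left_mono sum_mono c l)
    fix i assume "i \<in> K"
    then have "m * (u i)\<^sup>2 \<le> 1 / (\<phi> i)\<^sup>2 * (u i)\<^sup>2"
      using K by (intro mult_right_mono m) auto
    then show "m * (u i)\<^sup>2 \<le> (f i)\<^sup>2"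
      by (simp add: f_def power_divide)
  qed
  also have "\<dots> \<le> c * energy K f"
    by (intro mult_left_mono c l f)
  also have "\<dots> = (\<Sum>x\<in>darts_from (nbhd K). c * (f (source T x) - f (target T x))\<^sup>2) / 2"
    by (simp add: energy_def sum_distrib_left)
  also have "\<dots> \<le> (\<Sum>x\<in>darts_from (nbhd K). a (fst x) * \<phi> (source T x) * \<phi> (target T x)
        * (f (source T x) - f (target T x))\<^sup>2) / 2"
    by (intro divide_right_mono sum_mono mult_right_mono c) (auto simp: darts_from_def)
  also have "\<dots> = \<sigma> * (\<Sum>i\<in>K. (\<phi> i * f i)\<^sup>2) - (\<Sum>i\<in>K. \<phi> i * f i * jacobi T a b (\<lambda>i. \<phi> i * f i) i)"
    by (rule ground_state_form[OF f \<phi>, symmetric])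
  also have "\<dots> = \<sigma> * (\<Sum>i\<in>K. (u i)\<^sup>2) - (\<Sum>i\<in>K. u i * jacobi T a b u i)"
    by (simp only: u_eq fun_cong[OF u_eq])
  finally show "(\<Sum>i\<in>K. u i * jacobi T a b u i) \<le> (\<sigma> - m * c * l) * (\<Sum>i\<in>K. (u i)\<^sup>2)"
    by (simp add: left_diff_distrib)
qed

text \<open>The converse direction starts from an almost minimizer \<open>f\<close> of the free
  energy and tests with \<open>\<phi> f\<close>, whose mass is at least \<open>m\<close> times that
  of \<open>f\<close>.\<close>

lemma form_approx_ground_state:
  assumes \<phi>: "\<And>j. j \<in> verts T \<Longrightarrow> jacobi T a b \<phi> j = \<sigma> * \<phi> j"
    and C: "0 \<le> C" "\<And>x. x \<in> darts T \<Longrightarrow> a (fst x) * \<phi> (source T x) * \<phi> (target T x) \<le> C"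
    and m: "0 < m" "\<And>j. j \<in> verts T \<Longrightarrow> m \<le> (\<phi> j)\<^sup>2"
    and l: "0 \<le> l" "\<And>\<epsilon>. \<epsilon> > 0 \<Longrightarrow> \<exists>K f. test_function K f \<and> (\<Sum>i\<in>K. (f i)\<^sup>2) > 0 \<and>
      energy K f \<le> (l + \<epsilon>) * (\<Sum>i\<in>K. (f i)\<^sup>2)"
  shows "form_approx (\<sigma> - C / m * l)"
  unfolding form_approx_def
proof (intro allI impI)
  fix \<epsilon> :: real assume "\<epsilon> > 0"
  \<comment> \<open>The error \<delta> is amplified by \<open>C / m\<close>, which gives
    \<open>C / (C + 1) * \<epsilon> \<le> \<epsilon>\<close>; the denominator \<open>C + 1\<close>
    allows for \<open>C = 0\<close>.\<close>
  define \<delta> where "\<delta> = \<epsilon> * m / (C + 1)"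
  have \<delta>: "\<delta> > 0"
    using \<open>\<epsilon> > 0\<close> m C by (simp add: \<delta>_def)
  then obtain K f where f: "test_function K f" and f_pos: "(\<Sum>i\<in>K. (f i)\<^sup>2) > 0"
    and E: "energy K f \<le> (l + \<delta>) * (\<Sum>i\<in>K. (f i)\<^sup>2)"
    using l by blast
  define u where "u i = \<phi> i * f i" for i
  have K: "finite K" "K \<subseteq> verts T"
    using f by (auto simp: test_function_def)
  have u: "test_function K u"
    using f by (simp add: test_function_def u_def)
  define N where "N = (\<Sum>i\<in>K. (u i)\<^sup>2)"
  have fN: "m * (\<Sum>i\<in>K. (f i)\<^sup>2) \<le> N"
    unfolding N_def u_def sum_distrib_left power_mult_distrib
    using K by (intro sum_mono mult_right_mono m) auto
  then have N: "N > 0"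
    using m f_pos by (meson less_le_trans mult_pos_pos)
  have "\<sigma> * N - (\<Sum>i\<in>K. u i * jacobi T a b u i)
      = (\<Sum>x\<in>darts_from (nbhd K). a (fst x) * \<phi> (source T x) * \<phi> (target T x)
        * (f (source T x) - f (target T x))\<^sup>2) / 2"
    using ground_state_form[OF f \<phi>] by (simp add: N_def u_def[abs_def])
  also have "\<dots> \<le> (\<Sum>x\<in>darts_from (nbhd K). C * (f (source T x) - f (target T x))\<^sup>2) / 2"
    by (intro divide_right_mono sum_mono mult_right_mono C) (auto simp: darts_from_def)
  also have "\<dots> = C * energy K f"
    by (simp add: energy_def sum_distrib_left)
  also have "\<dots> \<le> C * ((l + \<delta>) * (\<Sum>i\<in>K. (f i)\<^sup>2))"
    by (intro mult_left_mono E C)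
  also have "\<dots> \<le> C * ((l + \<delta>) * (N / m))"
    using fN m l \<delta> C by (intro mult_left_mono) (auto simp: field_simps)
  also have "\<dots> = C / m * l * N + C / (C + 1) * \<epsilon> * N"
    using m C by (simp add: \<delta>_def field_simps)
  also have "\<dots> \<le> C / m * l * N + 1 * \<epsilon> * N"
    using N \<open>\<epsilon> > 0\<close> C by (intro add_left_mono mult_right_mono) (auto simp: divide_le_eq)
  finally have "(\<sigma> - C / m * l - \<epsilon>) * N \<le> (\<Sum>i\<in>K. u i * jacobi T a b u i)"
    by (simp add: algebra_simps)
  then show "\<exists>K u. test_function K u \<and> (\<Sum>i\<in>K. (u i)\<^sup>2) > 0 \<and>
      (\<sigma> - C / m * l - \<epsilon>) * (\<Sum>i\<in>K. (u i)\<^sup>2) \<le> (\<Sum>i\<in>K. u i * jacobi T a b u i)"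
    using u N unfolding N_def by blast
qed

end

section \<open>Lifting along the covering map\<close>

lemma covering_map_target:
  assumes "covering_map T G p q" "x \<in> darts T"
  shows "target G (q x) = p (target T x)"
proof -
  have "source G (q y) = p (source T y)" "q (flip y) = flip (q y)" if "y \<in> darts T" for y
    using assms(1) that by (auto simp: covering_map_def)
  from this(1)[of "flip x"] this(2)[of x] show ?thesis
    using assms(2) by simp
qed

text \<open>The lift reads the orientation \<open>True\<close> only; as \<open>q\<close> commutes
  with \<open>flip\<close>, the other orientation lies over the same edge.\<close>

lemma lift_edge_param_eq:
  assumes "covering_map T G p q" "x \<in> darts T"
  shows "lift_edge_param q a (fst x) = a (fst (q x))"
proof (cases x)
  case (Pair f s)
  have "q (flip x) = flip (q x)"
    using assms by (auto simp: covering_map_def)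
  then have "fst (q (f, \<not> s)) = fst (q (f, s))"
    by (metis Pair flip_def fst_conv fst_flip snd_conv)
  then show ?thesis
    by (cases s) (auto simp: lift_edge_param_def Pair)
qed

text \<open>\<open>q\<close> maps the star of \<open>v\<close> bijectively onto the star below,
  multiplicities and both darts of self-loops included. Hence \<open>\<psi> \<circ> p\<close> solves
  the eigenvalue equation on the tree.\<close>

lemma jacobi_lift:
  assumes cov: "covering_map T G p q" and v: "v \<in> verts T"
  shows "jacobi T (lift_edge_param q a) (lift_vertex_param p b) (\<lambda>i. \<psi> (p i)) v
    = jacobi G a b \<psi> (p v)"
proof -
  have bij: "bij_betw q (star T v) (star G (p v))" and "p v \<in> verts G"
    using cov v by (auto simp: covering_map_def)
  have "(\<Sum>x\<in>star T v. lift_edge_param q a (fst x) *\<^sub>R \<psi> (p (target T x)))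
      = (\<Sum>x\<in>star T v. a (fst (q x)) *\<^sub>R \<psi> (target G (q x)))"
    using lift_edge_param_eq[OF cov] covering_map_target[OF cov]
    by (intro sum.cong) (auto simp: star_def)
  also have "\<dots> = (\<Sum>y\<in>star G (p v). a (fst y) *\<^sub>R \<psi> (target G y))"
    by (rule sum.reindex_bij_betw[OF bij])
  finally show ?thesis
    using v \<open>p v \<in> verts G\<close>
    by (simp add: jacobi_def lift_vertex_param_def)
qed

theorem corollary2p4:
  fixes G :: "('v, 'e) multigraph" and T :: "('t, 'f) multigraph"
    and p :: "'t \<Rightarrow> 'v" and q :: "'f \<times> bool \<Rightarrow> 'e \<times> bool"
    and a :: "'e \<Rightarrow> real" and b :: "'v \<Rightarrow> real" and \<psi> :: "'v \<Rightarrow> real" and d :: nat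
  assumes "finite_multigraph G" and "connected_multigraph G" and "leafless G"
    and "\<forall>v\<in>verts G. degree G v = d"
    and "universal_cover T G p q"
    and "\<forall>\<alpha>\<in>edges G. a \<alpha> > 0"
    and "perron_vector G a b \<psi>"
  shows
    "let S = (SUP \<alpha>\<in>edges G. a \<alpha> * \<psi> (fst (ends G \<alpha>)) * \<psi> (snd (ends G \<alpha>)));
         S' = (SUP \<alpha>\<in>edges G. 1 / (a \<alpha> * \<psi> (fst (ends G \<alpha>)) * \<psi> (snd (ends G \<alpha>))));
         I = (INF i\<in>verts G. (\<psi> i)\<^sup>2);
         I' = (INF i\<in>verts G. 1 / (\<psi> i)\<^sup>2)
     in I' / S' * (real d - sqrt (4 * (real d - 1))) \<le> gap G T p q a b \<and>
        gap G T p q a b \<le> S / I * (real d - sqrt (4 * (real d - 1)))"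
proof -
  have wfG: "wf_multigraph G" and finV: "finite (verts G)" and finE: "finite (edges G)"
    using assms(1) by (auto simp: finite_multigraph_def)
  have tree: "is_tree T" and cov: "covering_map T G p q"
    using assms(5) by (auto simp: universal_cover_def)
  have p: "p v \<in> verts G" and bij: "bij_betw q (star T v) (star G (p v))" if "v \<in> verts T" for v
    using cov that by (auto simp: covering_map_def)
  have q: "q x \<in> darts G" "source G (q x) = p (source T x)" if "x \<in> darts T" for x
    using cov that by (auto simp: covering_map_def)
  have fin_darts: "finite (darts G)"
    using finE by (simp add: darts_def)
  then have finG: "finite (star G v)" for v
    by (simp add: star_def)
  obtain root where root: "root \<in> verts T"
    using tree by (auto simp: is_tree_def connected_multigraph_def)
  have d2: "d \<ge> 2"
    using assms(3,4) p[OF root] by (auto simp: leafless_def)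
  then have "star G (p root) \<noteq> {}"
    using assms(4) p[OF root] unfolding degree_def by (metis card.empty not_numeral_le_zero)
  then have neE: "edges G \<noteq> {}"
    by (auto simp: star_def darts_def)
  have neV: "verts G \<noteq> {}"
    using p[OF root] by auto
  define A where "A = (\<Sum>e\<in>edges G. \<bar>a e\<bar>) + (\<Sum>v\<in>verts G. \<bar>b v\<bar>)"
  have A: "\<bar>a e\<bar> \<le> A" if "e \<in> edges G" for e
    using member_le_sum[of e "edges G" "\<lambda>e. \<bar>a e\<bar>"] that finE by (simp add: A_def add_increasing2 sum_nonneg)
  have B: "\<bar>b v\<bar> \<le> A" if "v \<in> verts G" for v
    using member_le_sum[of v "verts G" "\<lambda>v. \<bar>b v\<bar>"] that finV by (simp add: A_def add_increasing sum_nonneg)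
  interpret branching_tree T d root
  proof
    show "wf_multigraph T"
      using tree by (simp add: is_tree_def)
    show "finite (star T v)" if "v \<in> verts T" for v
      using bij_betw_finite[OF bij[OF that]] finG by simp
    show "card (star T v) = d" if "v \<in> verts T" for v
      using bij_betw_same_card[OF bij[OF that]] assms(4) p[OF that] by (simp add: degree_def)
  qed (use tree root d2 in auto)
  interpret bounded_jacobi T d "lift_edge_param q a" "lift_vertex_param p b" A
  proof
    show "\<bar>lift_edge_param q a e\<bar> \<le> A" if "e \<in> edges T" for e
    proof -
      have "(e, True) \<in> darts T"
        using that by (simp add: darts_def)
      then show ?thesis
        using q(1) by (auto simp: lift_edge_param_def intro!: A fst_dart_in_edges)
    qed
    show "\<bar>lift_vertex_param p b v\<bar> \<le> A" if "v \<in> verts T" for v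
      using B p[OF that] by (simp add: lift_vertex_param_def)
  qed
  define w where "w \<alpha> = a \<alpha> * \<psi> (fst (ends G \<alpha>)) * \<psi> (snd (ends G \<alpha>))" for \<alpha>
  define S where "S = (SUP \<alpha>\<in>edges G. w \<alpha>)"
  define S' where "S' = (SUP \<alpha>\<in>edges G. 1 / w \<alpha>)"
  define I where "I = (INF i\<in>verts G. (\<psi> i)\<^sup>2)"
  define I' where "I' = (INF i\<in>verts G. 1 / (\<psi> i)\<^sup>2)"
  define \<sigma> where "\<sigma> = largest_eigenvalue G a b"
  define l where "l = real d - 2 * sqrt (real d - 1)"
  define \<phi> where "\<phi> i = \<psi> (p i)" for i
  have \<psi>_pos: "\<psi> j > 0" and \<psi>_eig: "jacobi G a b \<psi> j = \<sigma> * \<psi> j" if "j \<in> verts G" for j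
    using assms(7) that by (auto simp: perron_vector_def \<sigma>_def)
  have w_pos: "w \<alpha> > 0" if "\<alpha> \<in> edges G" for \<alpha>
    using that assms(6) wfG \<psi>_pos by (simp add: w_def wf_multigraph_def)
  have w_le: "w \<alpha> \<le> S" "1 / w \<alpha> \<le> S'" if "\<alpha> \<in> edges G" for \<alpha>
    unfolding S_def S'_def using that finE
    by (auto intro: cSUP_upper bdd_above_finite)
  obtain \<alpha>0 where \<alpha>0: "\<alpha>0 \<in> edges G"
    using neE by blast
  have S_pos: "S > 0" "S' > 0"
    using w_le[OF \<alpha>0] w_pos[OF \<alpha>0] zero_less_divide_1_iff[of "w \<alpha>0"] by linarith+
  \<comment> \<open>\<open>S'\<close> bounds the reciprocals from above, so its own reciprocal is
    the least edge weight allowed for in the lower bound.\<close>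
  have w_ge: "1 / S' \<le> w \<alpha>" if "\<alpha> \<in> edges G" for \<alpha>
    using w_le(2)[OF that] w_pos[OF that] S_pos by (simp add: field_simps)
  have I_le: "I \<le> (\<psi> j)\<^sup>2" "I' \<le> 1 / (\<psi> j)\<^sup>2" if "j \<in> verts G" for j
    unfolding I_def I'_def using that finV
    by (auto intro: cINF_lower bdd_below_finite)
  have "I \<in> (\<lambda>i. (\<psi> i)\<^sup>2) ` verts G"
    unfolding I_def using finV neV by (simp add: cInf_eq_Min)
  then have I_pos: "I > 0"
    using \<psi>_pos by fastforce
  have dart_w: "lift_edge_param q a (fst x) * \<phi> (source T x) * \<phi> (target T x) = w (fst (q x))"
    "fst (q x) \<in> edges G" if "x \<in> darts T" for x
  proof -
    \<comment> \<open>The weight is symmetric in the two ends, so the arbitrary order in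
      \<open>ends\<close> does not matter.\<close>
    have "w (fst y) = a (fst y) * \<psi> (source G y) * \<psi> (target G y)" for y
      by (auto simp: w_def source_def target_def flip_def)
    then show "lift_edge_param q a (fst x) * \<phi> (source T x) * \<phi> (target T x) = w (fst (q x))"
      using q(2)[OF that] covering_map_target[OF cov that] lift_edge_param_eq[OF cov that]
      by (simp add: \<phi>_def)
    show "fst (q x) \<in> edges G"
      using q(1)[OF that] by (rule fst_dart_in_edges)
  qed
  have \<phi>_eig: "jacobi T (lift_edge_param q a) (lift_vertex_param p b) \<phi> j = \<sigma> * \<phi> j"
    if "j \<in> verts T" for j
    using jacobi_lift[OF cov that, of a b \<psi>] \<psi>_eig[OF p[OF that]]
    by (simp add: \<phi>_def[abs_def])
  \<comment> \<open>In fact \<open>l = (sqrt (d - 1) - 1)^2\<close>.\<close>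
  have l: "0 \<le> l"
    using zero_le_power2[of "sqrt (real d - 1) - 1"] d2 by (simp add: l_def power2_diff)
  have "form_le (\<sigma> - I' * (1 / S') * l)"
  proof (rule form_le_ground_state[where \<phi> = \<phi>])
    show "\<phi> j > 0" "I' \<le> 1 / (\<phi> j)\<^sup>2" if "j \<in> verts T" for j
      using p[OF that] \<psi>_pos I_le by (auto simp: \<phi>_def)
    show "1 / S' \<le> lift_edge_param q a (fst x) * \<phi> (source T x) * \<phi> (target T x)"
      if "x \<in> darts T" for x
      using dart_w[OF that] w_ge by simp
    show "l * (\<Sum>i\<in>K. (f i)\<^sup>2) \<le> energy K f" if "test_function K f" for K f
      using energy_ge[OF that] by (simp add: l_def)
  qed (use S_pos l \<phi>_eig in auto)
  moreover have "form_approx (\<sigma> - S / I * l)"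
  proof (rule form_approx_ground_state[where \<phi> = \<phi>])
    show "I \<le> (\<phi> j)\<^sup>2" if "j \<in> verts T" for j
      using p[OF that] I_le by (auto simp: \<phi>_def)
    show "lift_edge_param q a (fst x) * \<phi> (source T x) * \<phi> (target T x) \<le> S"
      if "x \<in> darts T" for x
      using dart_w[OF that] w_le by simp
    show "\<exists>K f. test_function K f \<and> (\<Sum>i\<in>K. (f i)\<^sup>2) > 0 \<and>
      energy K f \<le> (l + \<epsilon>) * (\<Sum>i\<in>K. (f i)\<^sup>2)" if "\<epsilon> > 0" for \<epsilon>
      using energy_approx[OF that] unfolding l_def by metis
  qed (use S_pos I_pos l \<phi>_eig in auto)
  moreover have "verts T \<noteq> {}"
    using root by blast
  ultimately have "spectral_top T p q a b \<le> \<sigma> - I' * (1 / S') * l"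
    "\<sigma> - S / I * l \<le> spectral_top T p q a b"
    unfolding spectral_top_def periodic_jacobi_def
    by (blast intro: Sup_spectrum_bounds)+
  moreover have "real d - sqrt (4 * (real d - 1)) = l"
    unfolding real_sqrt_mult l_def by simp
  ultimately show ?thesis
    unfolding Let_def gap_def
    by (simp flip: w_def S_def S'_def I_def I'_def \<sigma>_def)
qed

end
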